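(* Let $s>1/2$ and let $(u_0,u_1)\in H^s(\mathbb{T}^3)\times H^{s-1}(\mathbb{T}^3)$ be real valued. For either choice of the sign $\pm$, let $u$ be the (local in time) solution of the Cauchy problem $$\partial_{tt}u-\Delta u+u\pm u^3=0,\qquad u(x,0)=u_0(x),\quad \partial_t u(x,0)=u_1(x),$$ on $\mathbb{T}^3\times[0,\delta]$ for some $\delta>0$. Then $$\lim_{t\to0}|u(t,x)-u_0(x)|=0\qquad\text{for (Lebesgue) almost every }x\in\mathbb{T}^3 .$$
   Context: $\mathbb{T}^3=(\mathbb{R}/2\pi\mathbb{Z})^3$; $\langle y\rangle=(1+|y|^2)^{1/2}$; $\langle D\rangle=\sqrt{1-\Delta}$ is the Fourier multiplier with symbol $\langle n\rangle$, $n\in\mathbb{Z}^3$. Restriction spaces. For functions $F$ on $\mathbb{R}\times\mathbb{T}^3$ with space-time Fourier transform $\widetilde F(n,\tau)$ (phase $e^{-i(n\cdot x+t\tau)}$), put $\|F\|_{X^{s,b}_{\pm}}^2=\int_{\mathbb{R}}\sum_{n\in\mathbb{Z}^3}\langle\tau\pm\langle n\rangle\rangle^{2b}\langle n\rangle^{2s}|\widetilde F(n,\tau)|^2d\tau$, and for functions on $[0,\delta]\times\mathbb{T}^3$ put $\|F\|_{X^{s,b}_{\delta,\pm}}=\inf\{\|G\|_{X^{s,b}_\pm}: G=F\text{ on }t\in[0,\delta]\}$. Meaning of "the solution". Write the equation as $\partial_{tt}u-\Delta u+u=\kappa u^3$, $\kappa\in\{1,-1\}$ ($\kappa=-1$ for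 the sign $+$ and $\kappa=1$ for the sign $-$ in front of $u^3$). Put $u_{0,\pm}=u_0\pm i\langle D\rangle^{-1}u_1$ and $u_\pm=u\pm i\langle D\rangle^{-1}\partial_tu$, so that $u=(u_++u_-)/2$ and the Cauchy problem is equivalent to the Duhamel system $$u_\pm(t)=e^{\mp it\langle D\rangle}u_{0,\pm}\pm i\kappa\int_0^t\frac{e^{\mp i(t-\tau)\langle D\rangle}}{\langle D\rangle}\Big(\frac{u_+(\tau)+u_-(\tau)}2\Big)^3d\tau .$$ Fix $b,s'$ with $1/2<b<s'<1$ and $s'\le s$. For $\delta>0$ small enough (depending on the data) this system has a unique solution $(u_+,u_-)\in X^{s',b}_{\delta,+}\times X^{s',b}_{\delta,-}$; the local solution is $u=(u_++u_-)/2$. Pointwise values. $u(t)$ is for each $t$ an element of a Sobolev space; its pointwise value is taken to be $u(t,x)=\lim_{k\to\infty}P_{\le 2^k}u(t)(x)$ wherever this limit exists, where $P_{\le N}$ is the frequency projection onto $\{|n|\le N\}$. *)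

theory Defs
  imports "HOL-Analysis.Analysis"
begin

section \<open>The torus, Fourier coefficients, frequency projections\<close>

text \<open>
  Functions on the torus are functions on \<open>real^3\<close> that are \<open>2 pi\<close>-periodic in every coordinate;
  integrals and null sets are taken on the period cell.
\<close>

definition torus :: "(real^3) measure" where
  "torus = lebesgue_on (cbox 0 (\<chi> i. 2 * pi))"

definition rvec :: "int^3 \<Rightarrow> real^3" where
  "rvec n = (\<chi> i. real_of_int (n $ i))"

definition torus_periodic :: "(real^3 \<Rightarrow> 'a) \<Rightarrow> bool" where
  "torus_periodic f \<longleftrightarrow> (\<forall>x m. f (x + (2 * pi) *\<^sub>R rvec m) = f x)"

definition japanese :: "'a::real_normed_vector \<Rightarrow> real" where
  "japanese y = sqrt (1 + (norm y)\<^sup>2)"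

definition fcoef :: "(real^3 \<Rightarrow> complex) \<Rightarrow> int^3 \<Rightarrow> complex" where
  "fcoef f n = (LINT x|torus. f x * cis (- (rvec n \<bullet> x))) / (2 * pi) ^ 3"

definition freq_proj :: "real \<Rightarrow> (real^3 \<Rightarrow> complex) \<Rightarrow> real^3 \<Rightarrow> complex" where
  "freq_proj N f x = (\<Sum>n | norm (rvec n) \<le> N. fcoef f n * cis (rvec n \<bullet> x))"

text \<open>
  The pointwise value of (the class of) \<open>f\<close>; it is meaningful only where \<open>has_ptvalue\<close> holds.
\<close>

definition has_ptvalue :: "(real^3 \<Rightarrow> complex) \<Rightarrow> real^3 \<Rightarrow> bool" where
  "has_ptvalue f x \<longleftrightarrow> convergent (\<lambda>k::nat. freq_proj (2 ^ k) f x)"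

definition ptvalue :: "(real^3 \<Rightarrow> complex) \<Rightarrow> real^3 \<Rightarrow> complex" where
  "ptvalue f x = lim (\<lambda>k::nat. freq_proj (2 ^ k) f x)"

section \<open>Periodic distributions and Sobolev spaces\<close>

definition partial :: "3 \<Rightarrow> (real^3 \<Rightarrow> complex) \<Rightarrow> real^3 \<Rightarrow> complex" where
  "partial i f x = vector_derivative (\<lambda>h. f (x + h *\<^sub>R axis i 1)) (at 0)"

abbreviation partials :: "3 list \<Rightarrow> (real^3 \<Rightarrow> complex) \<Rightarrow> real^3 \<Rightarrow> complex" where
  "partials is f \<equiv> foldr partial is f"

definition test_function :: "(real^3 \<Rightarrow> complex) \<Rightarrow> bool" where
  "test_function \<phi> \<longleftrightarrow> torus_periodic \<phi> \<and> (\<forall>is. partials is \<phi> differentiable_on UNIV)"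

text \<open>
  A distribution on the torus: a linear functional on the smooth periodic functions that is bounded
  by finitely many of the seminorms \<open>sup \<bar>partials is \<phi>\<bar>\<close>. Its values outside the test functions
  are irrelevant.
\<close>

definition distribution :: "((real^3 \<Rightarrow> complex) \<Rightarrow> complex) \<Rightarrow> bool" where
  "distribution T \<longleftrightarrow>
     (\<forall>\<phi> \<psi>. test_function \<phi> \<longrightarrow> test_function \<psi> \<longrightarrow> T (\<lambda>x. \<phi> x + \<psi> x) = T \<phi> + T \<psi>) \<and>
     (\<forall>c \<phi>. test_function \<phi> \<longrightarrow> T (\<lambda>x. c * \<phi> x) = c * T \<phi>) \<and>
     (\<exists>C N. \<forall>\<phi> M. test_function \<phi> \<longrightarrow>
        (\<forall>is x. length is \<le> N \<longrightarrow> cmod (partials is \<phi> x) \<le> M) \<longrightarrow> cmod (T \<phi>) \<le> C * M)"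

definition real_distribution :: "((real^3 \<Rightarrow> complex) \<Rightarrow> complex) \<Rightarrow> bool" where
  "real_distribution T \<longleftrightarrow> (\<forall>\<phi>. test_function \<phi> \<longrightarrow> range \<phi> \<subseteq> \<real> \<longrightarrow> T \<phi> \<in> \<real>)"

definition dcoef :: "((real^3 \<Rightarrow> complex) \<Rightarrow> complex) \<Rightarrow> int^3 \<Rightarrow> complex" where
  "dcoef T n = T (\<lambda>x. cis (- (rvec n \<bullet> x))) / (2 * pi) ^ 3"

definition sobolev_summable :: "real \<Rightarrow> (int^3 \<Rightarrow> complex) \<Rightarrow> bool" where
  "sobolev_summable \<sigma> a \<longleftrightarrow>
     (\<lambda>n. japanese (rvec n) powr (2 * \<sigma>) * (cmod (a n))\<^sup>2) summable_on UNIV"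

definition sobolev_distr :: "real \<Rightarrow> ((real^3 \<Rightarrow> complex) \<Rightarrow> complex) \<Rightarrow> bool" where
  "sobolev_distr \<sigma> T \<longleftrightarrow> distribution T \<and> sobolev_summable \<sigma> (dcoef T)"

text \<open>For \<open>\<sigma> \<ge> 0\<close> the elements of \<open>H\<^sup>\<sigma>\<close> are square integrable functions.\<close>

definition sobolev_fun :: "real \<Rightarrow> (real^3 \<Rightarrow> complex) \<Rightarrow> bool" where
  "sobolev_fun \<sigma> f \<longleftrightarrow> torus_periodic f \<and> f \<in> borel_measurable torus \<and>
     integrable torus (\<lambda>x. (cmod (f x))\<^sup>2) \<and> sobolev_summable \<sigma> (fcoef f)"

section \<open>Restriction spaces\<close>

definition L2_spacetime :: "(real \<Rightarrow> real^3 \<Rightarrow> complex) \<Rightarrow> bool" where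
  "L2_spacetime F \<longleftrightarrow> (\<forall>t. torus_periodic (F t)) \<and>
     case_prod F \<in> borel_measurable (lborel \<Otimes>\<^sub>M torus) \<and>
     integrable (lborel \<Otimes>\<^sub>M torus) (\<lambda>(t, x). (cmod (F t x))\<^sup>2)"

text \<open>
  \<open>Ft n \<tau>\<close> is the space-time Fourier transform of the square integrable function \<open>F\<close> at \<open>(n, \<tau>)\<close>.
  In time it is the Fourier--Plancherel transform, that is, the limit in \<open>L\<^sup>2(d\<tau>)\<close> of the Fourier
  integrals over \<open>[-R, R]\<close>; it is determined up to null sets of \<open>\<tau>\<close>.
\<close>

definition spacetime_fourier ::
    "(real \<Rightarrow> real^3 \<Rightarrow> complex) \<Rightarrow> (int^3 \<Rightarrow> real \<Rightarrow> complex) \<Rightarrow> bool" where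
  "spacetime_fourier F Ft \<longleftrightarrow> L2_spacetime F \<and>
     (\<forall>n. Ft n \<in> borel_measurable lborel \<and> integrable lborel (\<lambda>\<tau>. (cmod (Ft n \<tau>))\<^sup>2) \<and>
       ((\<lambda>R. \<integral>\<^sup>+\<tau>. ennreal ((cmod (
            (LINT t:{-R..R}|lborel. LINT x|torus. F t x * cis (- (rvec n \<bullet> x + t * \<tau>)))
            - Ft n \<tau>))\<^sup>2) \<partial>lborel) \<longlongrightarrow> 0) at_top)"

text \<open>
  The parameter \<open>sg\<close> is \<open>1\<close> or \<open>-1\<close> and stands for the sign in the spaces \<open>X\<^sup>s\<^sup>,\<^sup>b\<close> with index plus
  or minus. Norms are squared and have values in \<open>[0, \<infinity>]\<close>; \<open>X_norm_sq\<close> is expressed through the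
  Fourier transform of the function. This covers exactly the functions of finite norm
  when \<open>s, b \<ge> 0\<close>, since these are square integrable.
\<close>

definition X_norm_sq :: "real \<Rightarrow> real \<Rightarrow> real \<Rightarrow> (int^3 \<Rightarrow> real \<Rightarrow> complex) \<Rightarrow> ennreal" where
  "X_norm_sq sg s b Ft =
     (\<integral>\<^sup>+\<tau>. (\<integral>\<^sup>+n. ennreal (japanese (\<tau> + sg * japanese (rvec n)) powr (2 * b)
          * japanese (rvec n) powr (2 * s) * (cmod (Ft n \<tau>))\<^sup>2) \<partial>count_space UNIV) \<partial>lborel)"

definition X_restr_norm_sq ::
    "real \<Rightarrow> real \<Rightarrow> real \<Rightarrow> real \<Rightarrow> (real \<Rightarrow> real^3 \<Rightarrow> complex) \<Rightarrow> ennreal" where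
  "X_restr_norm_sq sg s b \<delta> F =
     Inf {X_norm_sq sg s b Gt | G Gt. spacetime_fourier G Gt \<and>
       (AE (t, x) in lborel \<Otimes>\<^sub>M torus. t \<in> {0..\<delta>} \<longrightarrow> G t x = F t x)}"

section \<open>The Duhamel system\<close>

text \<open>Fourier coefficients of \<open>u\<^sub>0 + sg i \<langle>D\<rangle>\<inverse> u\<^sub>1\<close>.\<close>

definition data_coef ::
    "real \<Rightarrow> (real^3 \<Rightarrow> complex) \<Rightarrow> ((real^3 \<Rightarrow> complex) \<Rightarrow> complex) \<Rightarrow> int^3 \<Rightarrow> complex" where
  "data_coef sg u0 u1 n =
     fcoef u0 n + complex_of_real sg * \<i> * dcoef u1 n / complex_of_real (japanese (rvec n))"

definition half_sum ::
    "(real \<Rightarrow> real^3 \<Rightarrow> complex) \<Rightarrow> (real \<Rightarrow> real^3 \<Rightarrow> complex) \<Rightarrow> real \<Rightarrow> real^3 \<Rightarrow> complex" where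
  "half_sum up um t x = (up t x + um t x) / 2"

definition duhamel_integrand ::
    "real \<Rightarrow> (real \<Rightarrow> real^3 \<Rightarrow> complex) \<Rightarrow> (real \<Rightarrow> real^3 \<Rightarrow> complex) \<Rightarrow>
     real \<Rightarrow> int^3 \<Rightarrow> real \<Rightarrow> complex" where
  "duhamel_integrand sg up um t n \<tau> =
     cis (- (sg * (t - \<tau>) * japanese (rvec n))) / complex_of_real (japanese (rvec n))
       * fcoef (\<lambda>x. (half_sum up um \<tau> x) ^ 3) n"

text \<open>
  The Duhamel equation for the component with sign \<open>sg\<close> on \<open>[0, \<delta>]\<close>, read for every \<open>t\<close> as an
  identity between Fourier coefficients; this includes that the time integral exists.
\<close>

definition duhamel_eq ::
    "real \<Rightarrow> real \<Rightarrow> real \<Rightarrow> (real^3 \<Rightarrow> complex) \<Rightarrow> ((real^3 \<Rightarrow> complex) \<Rightarrow> complex) \<Rightarrow>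
     (real \<Rightarrow> real^3 \<Rightarrow> complex) \<Rightarrow> (real \<Rightarrow> real^3 \<Rightarrow> complex) \<Rightarrow>
     (real \<Rightarrow> real^3 \<Rightarrow> complex) \<Rightarrow> bool" where
  "duhamel_eq sg \<kappa> \<delta> u0 u1 up um v \<longleftrightarrow>
     (\<forall>t\<in>{0..\<delta>}. \<forall>n.
        set_integrable lborel {0..t} (duhamel_integrand sg up um t n) \<and>
        fcoef (v t) n =
          cis (- (sg * t * japanese (rvec n))) * data_coef sg u0 u1 n
          + complex_of_real sg * \<i> * complex_of_real \<kappa>
            * (LINT \<tau>:{0..t}|lborel. duhamel_integrand sg up um t n \<tau>))"

text \<open>
  \<open>(up, um)\<close> is a solution of the system on \<open>[0, \<delta>]\<close> in the product of the two restriction spaces.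
  For \<open>b > 1/2\<close> these spaces embed into the continuous functions of time with values in \<open>H\<^sup>s\<close>:
  membership only determines \<open>up\<close> and \<open>um\<close> up to null sets of \<open>(t, x)\<close>, while the Duhamel equation,
  which holds for every \<open>t\<close>, selects the continuous representative.
\<close>

definition duhamel_solution ::
    "real \<Rightarrow> real \<Rightarrow> real \<Rightarrow> real \<Rightarrow> (real^3 \<Rightarrow> complex) \<Rightarrow> ((real^3 \<Rightarrow> complex) \<Rightarrow> complex) \<Rightarrow>
     (real \<Rightarrow> real^3 \<Rightarrow> complex) \<Rightarrow> (real \<Rightarrow> real^3 \<Rightarrow> complex) \<Rightarrow> bool" where
  "duhamel_solution \<kappa> s b \<delta> u0 u1 up um \<longleftrightarrow>
     (\<forall>t\<in>{0..\<delta>}. sobolev_fun s (up t) \<and> sobolev_fun s (um t)) \<and>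
     X_restr_norm_sq 1 s b \<delta> up < \<infinity> \<and> X_restr_norm_sq (-1) s b \<delta> um < \<infinity> \<and>
     duhamel_eq 1 \<kappa> \<delta> u0 u1 up um up \<and> duhamel_eq (-1) \<kappa> \<delta> u0 u1 up um um"

end

(* Defs comes last because HOL-Probability has another constant real_distribution. *)
theory Submission
  imports "HOL-Probability.Characteristic_Functions" Defs
begin

text \<open>
  Group the frequencies into the shells \<open>j - 1 < \<bar>n\<bar> \<le> j\<close>. On such a shell \<open>\<langle>n\<rangle>\<close> differs from \<open>j\<close> by at
  most one, so Fourier inversion in time bounds the part of \<open>u\<^sub>\<plusminus>(t)\<close> in the shell by
  \<open>Q\<^sub>j(x) = \<integral> \<bar>\<Sum>\<^sub>n F(n,\<tau>) e\<^sup>i\<^sup>n\<^sup>x\<bar> d\<tau>\<close> uniformly in \<open>t\<close>, where \<open>F\<close> is the space-time Fourier transform of an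
  extension of finite norm. By \<open>a \<le> 1/w + w a\<^sup>2\<close> with the weight
  \<open>w = \<langle>\<tau> \<plusminus> j\<rangle>\<^sup>2\<^sup>b (1 + j)\<^sup>2\<^sup>s\<close> and Parseval in \<open>x\<close>, the sum of the \<open>Q\<^sub>j\<close> is integrable as soon as \<open>b, s > 1/2\<close>.
  Hence for almost every \<open>x\<close> the dyadic partial sums converge uniformly in \<open>t\<close> and the pointwise value is
  continuous in time. The nonlinearity enters only through the continuity in time of the
  Fourier coefficients. At \<open>t = 0\<close> the limit has the Fourier coefficients of \<open>u\<^sub>0\<close>, by dominated
  convergence, and so agrees with \<open>u\<^sub>0\<close> almost everywhere.
\<close>

section \<open>Fourier coefficients on the torus\<close>

text \<open>The shells have width one, not dyadic width, because the modulus is taken after summing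
  over the \<open>n\<close> of a shell: a single modulation weight has to serve all of them. The
  price is the term 1/w. By translation in \<tau> its integral is a constant times (1+j)^(-2s), and
  there is one such term per integer radius j, not one per lattice point n; so s > 1/2 suffices
  where a bound frequency by frequency would ask for s > 3/2. The terms w a^2 add up to at most a
  constant times the squared restriction norm.

  On the time side, an extension agrees with the solution only almost everywhere on [0,\<delta>],
  and its transform is only an L^2 limit of truncated integrals. Inversion is therefore needed at a
  point near which the function has a continuous version, with no regularity elsewhere. Gaussian
  regularisation provides this at interior times, and continuity of the coefficients carries it to t
  = 0. On the space side, the coefficients must determine an integrable function almost everywhere;
  this comes from Stone-Weierstrass on a product of circles and Lebesgue differentiation.\<close>

lemma borel_measurable_cis [measurable (raw)]:
  "f \<in> borel_measurable M \<Longrightarrow> (\<lambda>x. cis (f x)) \<in> borel_measurable M"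
  by (rule measurable_compose[OF _ borel_measurable_continuous_onI])
     (auto intro!: continuous_on_cis continuous_intros)

lemma finite_measure_torus: "finite_measure torus"
  unfolding torus_def by (intro finite_measure_lebesgue_on) auto

interpretation torus: finite_measure torus
  by (rule finite_measure_torus)

lemma borel_measurable_torus:
  "f \<in> borel_measurable borel \<Longrightarrow> f \<in> borel_measurable torus"
  unfolding torus_def by (intro measurable_restrict_space1 measurable_completion) simp

text \<open>\<open>torus\<close> carries the completed measure, while the factorisation over
  coordinates is carried out for \<open>lborel\<close>; Borel integrands do not see the
  difference.\<close>

lemma LINT_torus:
  fixes f :: "real^3 \<Rightarrow> complex"
  assumes "f \<in> borel_measurable borel"
  shows "(LINT x|torus. f x) = (LINT x:cbox 0 (\<chi> i. 2 * pi)|lborel. f x)"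
  unfolding torus_def set_lebesgue_integral_def
  using assms by (subst integral_restrict_space) (auto intro!: integral_completion)

lemma continuous_integrable_torus:
  fixes f :: "real^3 \<Rightarrow> complex"
  assumes "continuous_on UNIV f"
  shows "integrable torus f"
proof -
  have "compact (f ` cbox 0 (\<chi> i. 2 * pi))"
    by (intro compact_continuous_image continuous_on_subset[OF assms]) auto
  then obtain B where B: "\<And>x. x \<in> cbox 0 (\<chi> i. 2 * pi) \<Longrightarrow> norm (f x) \<le> B"
    by (metis compact_imp_bounded bounded_iff imageI)
  show ?thesis
  proof (rule torus.integrable_const_bound[where B = B])
    show "AE x in torus. norm (f x) \<le> B"
      using B by (intro AE_I2) (auto simp: torus_def)
  qed (use assms in \<open>auto intro!: borel_measurable_torus borel_measurable_continuous_onI\<close>)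
qed

section \<open>Orthogonality of the exponentials and Parseval\<close>

lemma LINT_cis_period:
  "(LINT u:{0..2 * pi}|lborel. cis (of_int m * u)) = (if m = 0 then 2 * pi else 0)"
proof (cases "m = 0")
  case False
  have "(LINT u:{0..2 * pi}|lborel. cis (of_int m * u))
      = cis (of_int m * (2 * pi)) / (\<i> * of_int m) - cis (of_int m * 0) / (\<i> * of_int m)"
    unfolding set_lebesgue_integral_def
  proof (rule integral_FTC_Icc)
    fix x :: real
    have "((\<lambda>x. cis (of_int m * x)) has_vector_derivative (of_int m * \<i>) * cis (of_int m * x))
        (at x within {0..2 * pi})"
    proof -
      have "((\<lambda>z. exp (\<i> * (of_int m * z))) has_field_derivative
          of_int m * \<i> * exp (\<i> * (of_int m * of_real x))) (at (complex_of_real x))"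
        by (auto intro!: derivative_eq_intros)
      from has_vector_derivative_real_field[OF this] show ?thesis
        by (simp add: cis_conv_exp)
    qed
    then have "((\<lambda>x. cis (of_int m * x) / (\<i> * of_int m)) has_vector_derivative
        (of_int m * \<i>) * cis (of_int m * x) / (\<i> * of_int m)) (at x within {0..2 * pi})"
      by (rule has_vector_derivative_divide)
    then show "((\<lambda>x. cis (of_int m * x) / (\<i> * of_int m)) has_vector_derivative
        cis (of_int m * x)) (at x within {0..2 * pi})"
      using False by (simp add: field_simps)
  qed (auto intro!: continuous_intros continuous_on_cis)
  moreover have "cis (of_int m * (2 * pi)) = 1"
    using cis_multiple_2pi[of "of_int m"] by (simp add: mult.commute)
  ultimately show ?thesis using False by simp
next
  case True
  then show ?thesis
    by (simp add: set_lebesgue_integral_def scaleR_conv_of_real flip: integral_complex_of_real)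
qed

text \<open>The exponential and the indicator of the cell are both products over the coordinates, so
  the integral splits into three one-dimensional ones, and a single non-zero component of
  \<open>n\<close> makes it vanish.\<close>

lemma LINT_cis:
  "(LINT x|torus. cis (rvec n \<bullet> x)) = (if n = 0 then (2 * pi) ^ 3 else 0)"
proof -
  define h where "h b u = indicator {0..2 * pi} u *\<^sub>R cis ((rvec n \<bullet> b) * u)" for b :: "real^3" and u
  have int_h: "integrable lborel (h b)" for b
  proof -
    have "continuous_on {0..2 * pi} (\<lambda>u. cis ((rvec n \<bullet> b) * u))"
      by (intro continuous_on_cis continuous_intros)
    from borel_integrable_atLeastAtMost'[OF this] show ?thesis
      unfolding h_def set_integrable_def .
  qed
  have *: "indicator (cbox 0 (\<chi> i. 2 * pi)) x *\<^sub>R cis (rvec n \<bullet> x) = (\<Prod>b\<in>Basis. h b (x \<bullet> b))"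
    for x :: "real^3"
  proof -
    have "cis (rvec n \<bullet> x) = cis (\<Sum>b\<in>Basis. (rvec n \<bullet> b) * (x \<bullet> b))"
      by (subst euclidean_inner) simp
    also have "\<dots> = (\<Prod>b\<in>Basis. cis ((rvec n \<bullet> b) * (x \<bullet> b)))"
      by (simp add: cis_conv_exp sum_distrib_left exp_sum[symmetric])
    finally have 1: "cis (rvec n \<bullet> x) = (\<Prod>b\<in>Basis. cis ((rvec n \<bullet> b) * (x \<bullet> b)))" .
    have 2: "indicator (cbox 0 (\<chi> i. 2 * pi)) x = (\<Prod>b\<in>Basis. indicator {0..2 * pi} (x \<bullet> b) :: real)"
    proof -
      have mem: "x \<in> cbox 0 (\<chi> i. 2 * pi) \<longleftrightarrow> (\<forall>b\<in>Basis. x \<bullet> b \<in> {0..2 * pi})"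
        by (auto simp: mem_box Basis_vec_def inner_axis)
      show ?thesis
      proof (cases "\<forall>b\<in>Basis. x \<bullet> b \<in> {0..2 * pi}")
        case True
        then have "(\<Prod>b\<in>Basis. indicator {0..2 * pi} (x \<bullet> b) :: real) = 1"
          by (intro prod.neutral) simp
        with True show ?thesis by (simp add: mem)
      next
        case False
        then obtain b where b: "b \<in> Basis" "x \<bullet> b \<notin> {0..2 * pi}" by auto
        then have "(\<Prod>b\<in>Basis. indicator {0..2 * pi} (x \<bullet> b) :: real) = 0"
          by (intro prod_zero bexI[of _ b]) auto
        with False show ?thesis by (simp add: mem)
      qed
    qed
    show ?thesis unfolding 1 2 h_def by (simp add: scaleR_conv_of_real prod.distrib)
  qed
  have "(LINT x|torus. cis (rvec n \<bullet> x)) = (LINT x|lborel. (\<Prod>b\<in>Basis. h b (x \<bullet> b)))"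
    unfolding *[symmetric] by (subst LINT_torus) (auto simp: set_lebesgue_integral_def)
  also have "\<dots> = (LINT x|(\<Pi>\<^sub>M b\<in>Basis. lborel). (\<Prod>b\<in>Basis. h b ((\<Sum>b\<in>Basis. x b *\<^sub>R b) \<bullet> b)))"
    by (subst lborel_eq, subst integral_distr) (auto simp: h_def)
  also have "\<dots> = (LINT x|(\<Pi>\<^sub>M b\<in>Basis. lborel). (\<Prod>b\<in>Basis. h b (x b)))"
    by (intro Bochner_Integration.integral_cong refl prod.cong)
       (simp add: inner_sum_left inner_Basis if_distrib cong: if_cong)
  also have "\<dots> = (\<Prod>b\<in>(Basis :: (real^3) set). integral\<^sup>L lborel (h b))"
  proof -
    interpret product_sigma_finite "\<lambda>_ :: real^3. lborel :: real measure" ..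
    show ?thesis by (intro product_integral_prod int_h) auto
  qed
  also have "\<dots> = (\<Prod>i\<in>UNIV. (LINT u:{0..2 * pi}|lborel. cis (of_int (n $ i) * u)))"
  proof -
    have "h (axis i 1) = (\<lambda>u. indicator {0..2 * pi} u *\<^sub>R cis (of_int (n $ i) * u))" for i
      by (simp add: fun_eq_iff h_def inner_axis rvec_def)
    moreover have "bij_betw (\<lambda>i. axis i 1) UNIV (Basis :: (real^3) set)"
      by (auto simp: bij_betw_def inj_on_def axis_eq_axis Basis_vec_def)
    ultimately show ?thesis
      by (simp add: set_lebesgue_integral_def flip: prod.reindex_bij_betw)
  qed
  also have "\<dots> = (\<Prod>i\<in>UNIV. if n $ i = 0 then 2 * pi else 0)"
    unfolding LINT_cis_period by simp
  also have "\<dots> = (if n = 0 then (2 * pi) ^ 3 else 0)"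
    by (auto simp: vec_eq_iff prod_zero_iff)
  finally show ?thesis .
qed

lemma rvec_add: "rvec (m + n) = rvec m + rvec n"
  and rvec_minus: "rvec (- n) = - rvec n"
  and rvec_diff: "rvec (m - n) = rvec m - rvec n"
  by (simp_all add: rvec_def vec_eq_iff)

lemma rvec_zero [simp]: "rvec 0 = 0"
  by (simp add: rvec_def vec_eq_iff)

lemma finite_rvec_le: "finite {n. norm (rvec n) \<le> N}"
proof -
  have "finite ((\<lambda>f. \<chi> i. f i) ` (UNIV \<rightarrow>\<^sub>E {- \<lceil>N\<rceil>..\<lceil>N\<rceil>}) :: (int^3) set)"
    by (intro finite_imageI finite_PiE) auto
  moreover have "{n. norm (rvec n) \<le> N} \<subseteq> (\<lambda>f. \<chi> i. f i) ` (UNIV \<rightarrow>\<^sub>E {- \<lceil>N\<rceil>..\<lceil>N\<rceil>})"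
  proof
    fix n assume "n \<in> {n. norm (rvec n) \<le> N}"
    then have "\<bar>rvec n $ i\<bar> \<le> N" for i
      using component_le_norm_cart[of "rvec n" i] by simp
    then have "\<bar>real_of_int (n $ i)\<bar> \<le> N" for i
      by (simp add: rvec_def)
    then have "n $ i \<in> {- \<lceil>N\<rceil>..\<lceil>N\<rceil>}" for i
      by (smt (verit) atLeastAtMost_iff of_int_le_iff le_of_int_ceiling of_int_minus)
    then show "n \<in> (\<lambda>f. \<chi> i. f i) ` (UNIV \<rightarrow>\<^sub>E {- \<lceil>N\<rceil>..\<lceil>N\<rceil>})"
      by (intro image_eqI[of _ _ "vec_nth n"]) (auto simp: vec_eq_iff)
  qed
  ultimately show ?thesis by (rule finite_subset[rotated])
qed

text \<open>Expanding the square gives the frequencies n - m, and only the diagonal has non-zero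
  mean. The integral takes values in [0,\<infinity>] because it is used inside iterated integrals
  whose finiteness is established only later.\<close>

lemma parseval_torus:
  assumes "finite A"
  shows "(\<integral>\<^sup>+x. ennreal ((cmod (\<Sum>n\<in>A. a n * cis (rvec n \<bullet> x)))\<^sup>2) \<partial>torus)
    = ennreal ((2 * pi) ^ 3 * (\<Sum>n\<in>A. (cmod (a n))\<^sup>2))"
proof -
  let ?S = "\<lambda>x. \<Sum>n\<in>A. a n * cis (rvec n \<bullet> x)"
  have cont: "continuous_on UNIV (\<lambda>x. a n * cnj (a m) * cis (rvec (n - m) \<bullet> x))" for n m
    by (intro continuous_intros continuous_on_cis)
  have int: "integrable torus (\<lambda>x. a n * cnj (a m) * cis (rvec (n - m) \<bullet> x))" for n m
    by (intro continuous_integrable_torus cont)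
  have eq: "complex_of_real ((cmod (?S x))\<^sup>2)
      = (\<Sum>n\<in>A. \<Sum>m\<in>A. a n * cnj (a m) * cis (rvec (n - m) \<bullet> x))" for x
    unfolding complex_norm_square cnj_sum sum_product
    by (intro sum.cong refl) (simp add: cis_cnj rvec_diff inner_diff_left cis_mult mult.assoc mult.left_commute)
  have "integrable torus (\<lambda>x. complex_of_real ((cmod (?S x))\<^sup>2))"
    unfolding eq by (intro Bochner_Integration.integrable_sum int)
  then have int': "integrable torus (\<lambda>x. (cmod (?S x))\<^sup>2)"
    by (subst (asm) complex_of_real_integrable_eq)
  have "complex_of_real (LINT x|torus. (cmod (?S x))\<^sup>2)
      = (LINT x|torus. (\<Sum>n\<in>A. \<Sum>m\<in>A. a n * cnj (a m) * cis (rvec (n - m) \<bullet> x)))"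
    unfolding eq[symmetric] by (rule integral_complex_of_real[symmetric])
  also have "\<dots> = (\<Sum>n\<in>A. \<Sum>m\<in>A. a n * cnj (a m) * (LINT x|torus. cis (rvec (n - m) \<bullet> x)))"
    by (simp add: int Bochner_Integration.integral_sum Bochner_Integration.integrable_sum)
  also have "\<dots> = (\<Sum>n\<in>A. a n * cnj (a n) * (2 * pi) ^ 3)"
    using assms by (simp add: LINT_cis if_distrib sum.delta cong: if_cong)
  also have "\<dots> = complex_of_real ((2 * pi) ^ 3 * (\<Sum>n\<in>A. (cmod (a n))\<^sup>2))"
    by (simp add: sum_distrib_left complex_norm_square mult_ac del: of_real_power)
  finally have "(LINT x|torus. (cmod (?S x))\<^sup>2) = (2 * pi) ^ 3 * (\<Sum>n\<in>A. (cmod (a n))\<^sup>2)"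
    using of_real_eq_iff by blast
  then show ?thesis
    using nn_integral_eq_integral[OF int'] by simp
qed

section \<open>Fourier coefficients determine an integrable function\<close>

inductive trig_poly :: "(real^3 \<Rightarrow> complex) \<Rightarrow> bool" where
  mono: "trig_poly (\<lambda>x. c * cis (rvec n \<bullet> x))"
| add: "trig_poly f \<Longrightarrow> trig_poly g \<Longrightarrow> trig_poly (\<lambda>x. f x + g x)"

lemma trig_poly_const: "trig_poly (\<lambda>x. c)"
  using trig_poly.mono[of c 0] by simp

text \<open>Frequencies add under multiplication, so a double induction over the generators
  suffices. Closure under products is what allows polynomials to be pulled back to the
  torus.\<close>

lemma trig_poly_mult:
  assumes "trig_poly f" "trig_poly g"
  shows "trig_poly (\<lambda>x. f x * g x)"
  using assms
proof (induction f rule: trig_poly.induct)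
  case (mono c n)
  from mono show ?case
  proof (induction g rule: trig_poly.induct)
    case (mono d m)
    have "(\<lambda>x. c * cis (rvec n \<bullet> x) * (d * cis (rvec m \<bullet> x)))
        = (\<lambda>x. (c * d) * cis (rvec (n + m) \<bullet> x))"
      by (simp add: rvec_add inner_add_left cis_mult[symmetric] mult_ac)
    then show ?case by (simp only: trig_poly.mono)
  next
    case (add f g)
    then show ?case by (simp only: distrib_left trig_poly.add)
  qed
next
  case (add f g)
  then show ?case by (simp only: distrib_right trig_poly.add)
qed

lemma trig_poly_sum:
  "finite A \<Longrightarrow> (\<And>i. i \<in> A \<Longrightarrow> trig_poly (f i)) \<Longrightarrow> trig_poly (\<lambda>x. \<Sum>i\<in>A. f i x)"
  by (induction A rule: finite_induct) (auto intro: trig_poly_const trig_poly.add)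

lemma trig_poly_cis: "trig_poly (\<lambda>x. cis (x $ i))" "trig_poly (\<lambda>x. cis (- (x $ i)))"
proof -
  have "rvec (axis i 1) \<bullet> x = x $ i" "rvec (- axis i 1) \<bullet> x = - (x $ i)" for x
    by (simp_all add: rvec_def axis_def inner_vec_def if_distrib if_distribR sum.If_cases cong: if_cong)
  then show "trig_poly (\<lambda>x. cis (x $ i))" "trig_poly (\<lambda>x. cis (- (x $ i)))"
    using trig_poly.mono[of 1 "axis i 1"] trig_poly.mono[of 1 "- axis i 1"] by simp_all
qed

lemma trig_poly_cos: "trig_poly (\<lambda>x. of_real (cos (x $ i)))"
  and trig_poly_sin: "trig_poly (\<lambda>x. of_real (sin (x $ i)))"
proof -
  have "(\<lambda>x. of_real (cos (x $ i))) = (\<lambda>x. 1/2 * (cis (x $ i) + cis (- (x $ i))))"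
    by (auto simp: complex_eq_iff)
  then show "trig_poly (\<lambda>x. of_real (cos (x $ i)))"
    by (simp only:) (intro trig_poly_mult trig_poly_const trig_poly.add trig_poly_cis)
  have "(\<lambda>x. of_real (sin (x $ i))) = (\<lambda>x. (-\<i>/2) * (cis (x $ i) + (-1) * cis (- (x $ i))))"
    by (auto simp: complex_eq_iff)
  then show "trig_poly (\<lambda>x. of_real (sin (x $ i)))"
    by (simp only:) (intro trig_poly_mult trig_poly_const trig_poly.add trig_poly_cis)
qed

text \<open>Maps the torus onto a product of three unit circles. Continuous functions of
  \<open>circles x\<close> are periodic, and polynomial approximation on the compact image becomes
  trigonometric approximation.\<close>

definition circles :: "real^3 \<Rightarrow> complex^3" where
  "circles x = (\<chi> i. cis (x $ i))"

lemma continuous_on_circles [continuous_intros]: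
  "continuous_on S circles"
  unfolding circles_def by (intro continuous_on_vec_lambda continuous_on_cis continuous_intros)

text \<open>A real-linear functional of \<open>circles x\<close> is a combination of the cosines and
  sines of the coordinates; constants, sums and products are closure properties.\<close>

lemma trig_poly_real_polynomial:
  assumes "real_polynomial_function p"
  shows "trig_poly (\<lambda>x. of_real (p (circles x)))"
  using assms
proof (induction p rule: real_polynomial_function.induct)
  case (linear f)
  interpret bounded_linear f by fact
  have "f (circles x) = (\<Sum>i\<in>UNIV. cos (x $ i) * f (axis i 1) + sin (x $ i) * f (axis i \<i>))" for x
  proof -
    have "circles x = (\<Sum>i\<in>UNIV. cos (x $ i) *\<^sub>R axis i 1 + sin (x $ i) *\<^sub>R axis i \<i>)"
      by (auto simp: circles_def vec_eq_iff axis_def complex_eq_iff if_distrib sum.If_cases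
          cong: if_cong)
    then show ?thesis by (simp add: sum add scaleR)
  qed
  then have "of_real (f (circles x)) = (\<Sum>i\<in>UNIV. of_real (cos (x $ i)) * of_real (f (axis i 1))
      + of_real (sin (x $ i)) * complex_of_real (f (axis i \<i>)))" for x by simp
  then show ?case
    by (simp only:) (intro trig_poly_sum trig_poly.add trig_poly_mult trig_poly_const
      trig_poly_cos trig_poly_sin finite)
qed (simp_all add: trig_poly_const trig_poly.add trig_poly_mult)

text \<open>Pairing with frequency \<open>n\<close> is the coefficient at \<open>- n\<close>, as
  \<open>fcoef\<close> integrates against the conjugate exponential. Integrability is carried
  through the induction because additivity of the integral needs it.\<close>

lemma integral_trig_poly_zero:
  assumes f: "integrable torus f" and zero: "\<And>n. fcoef f n = 0" and "trig_poly p"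
  shows "integrable torus (\<lambda>x. f x * p x) \<and> (LINT x|torus. f x * p x) = 0"
  using \<open>trig_poly p\<close>
proof (induction p rule: trig_poly.induct)
  case (mono c n)
  have int: "integrable torus (\<lambda>x. f x * cis (rvec n \<bullet> x))"
    by (rule Bochner_Integration.integrable_bound[OF f])
       (use f in \<open>auto simp: norm_mult intro!: borel_measurable_times borel_measurable_torus[of "\<lambda>x. cis (rvec n \<bullet> x)"]\<close>)
  have "(LINT x|torus. f x * cis (rvec n \<bullet> x)) = 0"
    using zero[of "- n"] by (simp add: fcoef_def rvec_minus)
  then show ?case using int by (simp add: mult.left_commute)
next
  case (add p q)
  then show ?case by (simp add: distrib_left)
qed

lemma cis_eq_imp_eq:
  assumes "cis u = cis v" "\<bar>u - v\<bar> < 2 * pi"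
  shows "u = v"
proof -
  from assms(1) have "sin u = sin v \<and> cos u = cos v" by (metis cis.sel)
  then obtain k :: int where k: "u = v + 2 * pi * k" using sin_cos_eq_iff by blast
  then have "2 * pi * \<bar>real_of_int k\<bar> < 2 * pi * 1" using assms(2) by (simp add: abs_mult)
  then have "\<bar>real_of_int k\<bar> < 1" by (subst (asm) mult_less_cancel_left_pos) auto
  then show ?thesis using k by simp
qed

text \<open>The indicator of the box is, on the cell, a bounded pointwise limit of trigonometric
  polynomials, and \<open>f\<close> is orthogonal to each of these. Dominated convergence concludes,
  so \<open>f\<close> need only be integrable. The box has to lie in the open cell because
  \<open>circles\<close> identifies opposite faces.\<close>

lemma set_integral_cbox_zero:
  assumes f: "integrable torus f" and zero: "\<And>n. fcoef f n = 0"
    and ab: "cbox a b \<subseteq> box 0 (\<chi> i. 2 * pi)"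
  shows "(LINT x|torus. indicator (cbox a b) x *\<^sub>R f x) = 0"
proof -
  define K where "K = circles ` cbox 0 (\<chi> i. 2 * pi)"
  define C where "C = circles ` cbox a b"
  have K: "compact K" unfolding K_def by (intro compact_continuous_image continuous_intros) auto
  have C: "compact C" unfolding C_def by (intro compact_continuous_image continuous_intros) auto
  \<comment> \<open>With one point in the closed and the other in the open cell, coordinates differ
    by strictly less than 2 pi. Two points of the closed cell could be glued.\<close>
  have circ_eq: "x = y" if "circles x = circles y" "x \<in> cbox 0 (\<chi> i. 2 * pi)" "y \<in> box 0 (\<chi> i. 2 * pi)" for x y
  proof -
    have "x $ i = y $ i" for i
    proof -
      have "cis (x $ i) = cis (y $ i)" using that(1) by (simp add: circles_def vec_eq_iff)
      moreover have "\<bar>x $ i - y $ i\<bar> < 2 * pi"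
      proof -
        have "0 \<le> x $ i" "x $ i \<le> 2 * pi" "0 < y $ i" "y $ i < 2 * pi"
          using that(2,3) by (auto simp: mem_box_cart)
        then show ?thesis by linarith
      qed
      ultimately show ?thesis by (intro cis_eq_imp_eq)
    qed
    then show ?thesis by (simp add: vec_eq_iff)
  qed
  have mem_C: "circles x \<in> C \<longleftrightarrow> x \<in> cbox a b" if "x \<in> cbox 0 (\<chi> i. 2 * pi)" for x
    using circ_eq[OF _ that] ab unfolding C_def by auto
  show ?thesis
  \<comment> \<open>\<open>infdist\<close> to the empty set is 0 by default, so the cut-offs below
    would not be small.\<close>
  proof (cases "cbox a b = {}")
    case False
    then have "C \<noteq> {}" by (simp add: C_def)
    \<comment> \<open>Continuous cut-offs, equal to 1 on \<open>C\<close> and tending to 0 at every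
      point off \<open>C\<close>, since \<open>C\<close> is closed.\<close>
    define \<phi> where "\<phi> m z = max 0 (1 - real m * infdist z C)" for m z
    have \<phi>01: "0 \<le> \<phi> m z" "\<phi> m z \<le> 1" for m z
      unfolding \<phi>_def using infdist_nonneg[of z C] by (auto simp: max_def)
    have "\<exists>g. real_polynomial_function g \<and> (\<forall>z\<in>K. \<bar>\<phi> m z - g z\<bar> < 1 / real (Suc m))" for m
    proof -
      have "continuous_on K (\<phi> m)" unfolding \<phi>_def by (intro continuous_intros)
      from Stone_Weierstrass_polynomial_function[OF K this, of "1 / real (Suc m)"]
      show ?thesis by (simp only: real_polynomial_function_eq real_norm_def) simp
    qed
    then obtain g where g: "\<And>m. real_polynomial_function (g m)"
      and gK: "\<And>m z. z \<in> K \<Longrightarrow> \<bar>\<phi> m z - g m z\<bar> < 1 / real (Suc m)"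
      by metis
    have gp: "integrable torus (\<lambda>x. f x * of_real (g m (circles x)))
        \<and> (LINT x|torus. f x * of_real (g m (circles x))) = 0" for m
      by (rule integral_trig_poly_zero[OF f zero trig_poly_real_polynomial[OF g]])
    have lim_g: "(\<lambda>m. g m (circles x)) \<longlonglongrightarrow> indicator (cbox a b) x"
      if x: "x \<in> cbox 0 (\<chi> i. 2 * pi)" for x
    proof -
      have "(\<lambda>m. \<phi> m (circles x)) \<longlonglongrightarrow> indicator (cbox a b) x"
      proof (cases "x \<in> cbox a b")
        case True
        then have "infdist (circles x) C = 0" using mem_C[OF x] by (simp add: infdist_zero)
        then show ?thesis using True by (simp add: \<phi>_def)
      next
        case False
        then have "circles x \<notin> C" using mem_C[OF x] by simp
        then have pos: "infdist (circles x) C > 0"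
          using in_closed_iff_infdist_zero[OF compact_imp_closed[OF C] \<open>C \<noteq> {}\<close>, of "circles x"]
            infdist_nonneg[of "circles x" C] by simp
        obtain N :: nat where N: "1 / infdist (circles x) C < real N" using reals_Archimedean2 by blast
        have "\<phi> m (circles x) = 0" if "m \<ge> N" for m
        proof -
          have "1 / infdist (circles x) C \<le> real m" using N that by linarith
          then have "1 \<le> real m * infdist (circles x) C" using pos by (simp add: field_simps)
          then show ?thesis by (simp add: \<phi>_def)
        qed
        then have "eventually (\<lambda>m. \<phi> m (circles x) = 0) sequentially"
          using eventually_sequentially by blast
        then show ?thesis using False by (simp add: tendsto_eventually)
      qed
      moreover have "(\<lambda>m. g m (circles x) - \<phi> m (circles x)) \<longlonglongrightarrow> 0"
      proof (rule Lim_null_comparison)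
        show "\<forall>\<^sub>F m in sequentially. norm (g m (circles x) - \<phi> m (circles x)) \<le> 1 / real (Suc m)"
        proof (intro always_eventually allI)
          fix m
          have "circles x \<in> K" using x by (simp add: K_def)
          from gK[OF this, of m] show "norm (g m (circles x) - \<phi> m (circles x)) \<le> 1 / real (Suc m)"
            by (simp add: abs_minus_commute del: of_nat_Suc)
        qed
        show "(\<lambda>m. 1 / real (Suc m)) \<longlonglongrightarrow> 0"
          using LIMSEQ_inverse_real_of_nat by (simp add: inverse_eq_divide)
      qed
      ultimately show ?thesis by (rule Lim_transform)
    qed
    have "(\<lambda>m. LINT x|torus. f x * of_real (g m (circles x)))
        \<longlonglongrightarrow> (LINT x|torus. indicator (cbox a b) x *\<^sub>R f x)"
    \<comment> \<open>The 2 is the bound 1 for the cut-off plus the approximation error, at most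
      1.\<close>
    proof (rule integral_dominated_convergence[where w = "\<lambda>x. 2 * norm (f x)"])
      show "AE x in torus. (\<lambda>m. f x * of_real (g m (circles x))) \<longlonglongrightarrow> indicator (cbox a b) x *\<^sub>R f x"
      proof (intro AE_I2)
        fix x assume "x \<in> space torus"
        then have "x \<in> cbox 0 (\<chi> i. 2 * pi)" by (simp add: torus_def)
        from tendsto_mult[OF tendsto_const[of "f x"] tendsto_of_real[OF lim_g[OF this]]]
        show "(\<lambda>m. f x * of_real (g m (circles x))) \<longlonglongrightarrow> indicator (cbox a b) x *\<^sub>R f x"
          by (simp add: scaleR_conv_of_real mult.commute)
      qed
      show "AE x in torus. norm (f x * of_real (g m (circles x))) \<le> 2 * norm (f x)" for m
      proof (intro AE_I2)
        fix x assume "x \<in> space torus"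
        then have "circles x \<in> K" by (simp add: torus_def K_def)
        moreover have "1 / real (Suc m) \<le> 1" by simp
        ultimately have "\<bar>\<phi> m (circles x) - g m (circles x)\<bar> < 1" using gK[of "circles x" m] by linarith
        then have "\<bar>g m (circles x)\<bar> \<le> 2"
          using \<phi>01[of m "circles x"] by linarith
        then have "norm (f x) * \<bar>g m (circles x)\<bar> \<le> norm (f x) * 2"
          by (intro mult_left_mono) auto
        then show "norm (f x * of_real (g m (circles x))) \<le> 2 * norm (f x)"
          by (simp add: norm_mult)
      qed
      show "(\<lambda>x. f x * of_real (g m (circles x))) \<in> borel_measurable torus" for m
        by (rule borel_measurable_integrable[OF conjunct1[OF gp]])
      show "(\<lambda>x. indicator (cbox a b) x *\<^sub>R f x) \<in> borel_measurable torus"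
        by (intro borel_measurable_scaleR borel_measurable_integrable[OF f] borel_measurable_torus
            borel_measurable_indicator) simp
      show "integrable torus (\<lambda>x. 2 * norm (f x))" using f by simp
    qed
    moreover have "(LINT x|torus. f x * of_real (g m (circles x))) = 0" for m
      by (rule conjunct2[OF gp])
    ultimately show ?thesis by (simp add: LIMSEQ_const_iff)
  qed simp
qed

text \<open>Integrals over small cubes inside the open cell vanish, so Lebesgue differentiation
  forces \<open>f\<close> to vanish almost everywhere there; the boundary of the cell is negligible.
  The extension \<open>F\<close> by zero makes the differentiation theorem on the whole space
  applicable.\<close>

lemma fcoef_zero_imp_AE_zero:
  assumes f: "integrable torus f" and zero: "\<And>n. fcoef f n = 0"
  shows "AE x in torus. f x = 0"
proof -
  define Q where "Q = cbox (0 :: real^3) (\<chi> i. 2 * pi)"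
  define F where "F x = indicator Q x *\<^sub>R f x" for x
  have F: "integrable lebesgue F"
    using f unfolding torus_def F_def Q_def by (subst (asm) integrable_restrict_space) auto
  have Fab: "integrable lebesgue (\<lambda>x. indicator (cbox a b) x *\<^sub>R F x)" for a b
    by (rule Bochner_Integration.integrable_bound[OF F])
       (use F in \<open>auto intro!: borel_measurable_scaleR borel_measurable_indicator split: split_indicator\<close>)
  have "F integrable_on cbox a b" for a b
    using Fab[of a b] set_lebesgue_integral_eq_integral(1)[of "cbox a b" F]
    by (simp add: set_integrable_def)
  then obtain N where N: "negligible N"
    and lim: "\<And>x e. \<lbrakk>x \<notin> N; 0 < e\<rbrakk> \<Longrightarrow> \<exists>d>0. \<forall>h. 0 < h \<and> h < d \<longrightarrow>
       norm (integral (cbox x (x + h *\<^sub>R One)) F /\<^sub>R h ^ DIM(real^3) - F x) < e"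
    using integrable_ccontinuous_explicit[of F] by blast
  have F0: "F x = 0" if x: "x \<in> box 0 (\<chi> i. 2 * pi)" "x \<notin> N" for x
  proof (rule ccontr)
    assume "F x \<noteq> 0"
    with lim[OF x(2), of "norm (F x)"] obtain d where d: "d > 0"
      "\<And>h. 0 < h \<Longrightarrow> h < d \<Longrightarrow> norm (integral (cbox x (x + h *\<^sub>R One)) F /\<^sub>R h ^ DIM(real^3) - F x) < norm (F x)"
      by auto
    obtain e where e: "e > 0" "ball x e \<subseteq> box 0 (\<chi> i. 2 * pi)"
      using x(1) open_box open_contains_ball by blast
    \<comment> \<open>A point of the cube of side h is within 3h of the corner in the l^1 norm, and
      3h \<le> 3e/4 < e keeps the cube in the ball.\<close>
    define h where "h = min (d / 2) (e / 4)"
    have h: "0 < h" "h < d" "h \<le> e / 4" using d(1) e(1) by (auto simp: h_def)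
    have One: "(One :: real^3) $ i = 1" for i
      by (simp add: cart_eq_inner_axis)
    have sub: "cbox x (x + h *\<^sub>R One) \<subseteq> ball x e"
    proof
      fix y assume "y \<in> cbox x (x + h *\<^sub>R One)"
      then have "x $ i \<le> y $ i \<and> y $ i \<le> x $ i + h" for i
        by (simp add: mem_box_cart One[unfolded sum_component])
      from this have "\<bar>(y - x) $ i\<bar> \<le> h" for i
        unfolding vector_minus_component using h(1) by (smt (verit))
      then have "norm (y - x) \<le> (\<Sum>i\<in>(UNIV::3 set). h)"
        by (intro order.trans[OF norm_le_l1_cart] sum_mono) auto
      also have "\<dots> < e" using h e(1) by simp
      finally show "y \<in> ball x e" by (simp add: dist_norm norm_minus_commute)
    qed
    have "integral (cbox x (x + h *\<^sub>R One)) F = (LINT y|lebesgue. indicator (cbox x (x + h *\<^sub>R One)) y *\<^sub>R F y)"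
      using Fab set_lebesgue_integral_eq_integral(2)[of "cbox x (x + h *\<^sub>R One)" F]
      by (simp add: set_integrable_def set_lebesgue_integral_def)
    also have "\<dots> = (LINT y|torus. indicator (cbox x (x + h *\<^sub>R One)) y *\<^sub>R f y)"
      unfolding torus_def F_def Q_def by (subst integral_restrict_space) (auto simp: mult.commute)
    also have "\<dots> = 0"
      using sub e(2) by (intro set_integral_cbox_zero[OF f zero]) auto
    finally show False using d(2)[OF h(1,2)] by simp
  qed
  have "negligible (N \<union> (Q - box 0 (\<chi> i. 2 * pi)))"
    unfolding Q_def using N negligible_frontier_interval by (intro negligible_Un) auto
  then have "AE x in lebesgue. x \<notin> N \<union> (Q - box 0 (\<chi> i. 2 * pi))"
    by (rule AE_not_in[OF iffD1[OF negligible_iff_null_sets]])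
  moreover have FQ: "F x = f x" if "x \<in> Q" for x
    using that by (simp add: F_def)
  ultimately have "AE x in lebesgue. x \<in> Q \<longrightarrow> f x = 0"
    by eventually_elim (metis F0 FQ Diff_iff Un_iff)
  then show ?thesis
    unfolding torus_def Q_def by (subst AE_restrict_space_iff) auto
qed

section \<open>Fourier inversion on the real line\<close>

lemma norm_integral_le_AE:
  fixes f :: "'a \<Rightarrow> 'b::{banach, second_countable_topology}"
  assumes g: "integrable M g" and f: "f \<in> borel_measurable M" and le: "AE x in M. norm (f x) \<le> g x"
  shows "norm (integral\<^sup>L M f) \<le> integral\<^sup>L M g"
proof -
  have "AE x in M. norm (f x) \<le> norm (g x)"
    using le by eventually_elim simp
  then have "integrable M f" by (rule Bochner_Integration.integrable_bound[OF g f])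
  have "norm (integral\<^sup>L M f) \<le> (LINT x|M. norm (f x))" by (rule integral_norm_bound)
  also have "\<dots> \<le> integral\<^sup>L M g"
    using \<open>integrable M f\<close> g le by (intro integral_mono_AE integrable_norm)
  finally show ?thesis .
qed

section \<open>Integrability of the inverse modulation weight\<close>

lemma integrable_powr_ge_1:
  fixes e :: real
  assumes "e < -1"
  shows "integrable lborel (\<lambda>x. indicator {1..} x * x powr e)"
proof (rule integrableI_nonneg)
  have "((\<lambda>x. x powr e) has_integral -(1 powr (e+1)) / (e+1)) {1..}"
    using assms by (intro has_integral_powr_to_inf) auto
  then have "((\<lambda>x. indicator {1..} x * x powr e) has_integral -(1 powr (e+1)) / (e+1)) UNIV"
    by (subst (asm) has_integral_restrict_UNIV[symmetric])
       (simp add: indicator_def if_distrib if_distribR of_bool_def cong: if_cong)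
  then have "(\<integral>\<^sup>+x. ennreal (indicator {1..} x * x powr e) \<partial>lborel) = ennreal (-(1 powr (e+1)) / (e+1))"
    by (intro nn_integral_has_integral_lborel) auto
  then show "(\<integral>\<^sup>+x. ennreal (indicator {1..} x * x powr e) \<partial>lborel) < \<infinity>"
    by simp
qed auto

lemma japanese_real: "japanese (x :: real) = sqrt (1 + x\<^sup>2)"
  by (simp add: japanese_def)

lemma japanese_ge_1: "1 \<le> japanese x"
  by (simp add: japanese_def)

lemma japanese_pos: "0 < japanese x"
  using japanese_ge_1[of x] by simp

lemma norm_le_japanese: "norm x \<le> japanese x"
  unfolding japanese_def by (intro real_le_rsqrt) simp

lemma borel_measurable_japanese [measurable]:
  "japanese \<in> borel_measurable (borel :: real measure)"
  unfolding japanese_def by measurable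

text \<open>The condition on \<open>b\<close> is convergence at infinity: the majorant is 1 on
  [-1,1] and |x|^(-2b) outside. The shift \<open>c\<close> costs nothing by translation
  invariance.\<close>

lemma integrable_japanese_powr:
  assumes "b > 1/2"
  shows "integrable lborel (\<lambda>x :: real. japanese (x + c) powr (- (2 * b)))"
proof -
  let ?w = "\<lambda>x :: real. indicator {-1..1} x + indicator {1..} x * x powr (- (2 * b))
      + indicator {1..} (- x) * (- x) powr (- (2 * b))"
  have 1: "integrable lborel (\<lambda>x. indicator {1..} x * x powr (- (2 * b)))"
    using assms by (intro integrable_powr_ge_1) simp
  from lborel_integrable_real_affine[OF this, of "-1" 0]
  have "integrable lborel ?w"
    by (intro Bochner_Integration.integrable_add 1) simp_all
  then have "integrable lborel (\<lambda>x :: real. japanese x powr (- (2 * b)))"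
  proof (rule Bochner_Integration.integrable_bound)
    have "japanese x powr (- (2 * b)) \<le> ?w x" for x :: real
    proof -
      have *: "japanese x powr (- (2 * b)) \<le> \<bar>x\<bar> powr (- (2 * b))" if "x \<noteq> 0"
        using norm_le_japanese[of x] that assms by (intro powr_mono2') auto
      have 1: "japanese x powr (- (2 * b)) \<le> 1"
        using powr_mono2'[of "- (2 * b)" 1 "japanese x"] japanese_ge_1[of x] assms by simp
      consider "x \<in> {-1..1}" | "x > 1" | "x < -1" by fastforce
      then show ?thesis
      proof cases
        case 1
        then show ?thesis using \<open>japanese x powr (- (2 * b)) \<le> 1\<close>
          by (intro order.trans[OF _ add_increasing2[OF _ add_increasing2[OF _ order.refl]]]) auto
      qed (use * in auto)
    qed
    then show "AE x in lborel. norm (japanese x powr (- (2 * b))) \<le> norm (?w x)"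
      by (intro AE_I2) (smt (verit) powr_ge_zero real_norm_def)
  qed measurable
  from lborel_integrable_real_affine[OF this, of 1 c] show ?thesis by (simp add: add.commute)
qed

section \<open>Gaussian regularisation of the inversion formula\<close>

lemma gaussian_integrable:
  fixes e :: real
  assumes "e > 0"
  shows "integrable lborel (\<lambda>x. exp (- (e * x)\<^sup>2 / 2))"
proof -
  have "integrable lborel (\<lambda>x. sqrt (2 * pi) * std_normal_density x)"
    by simp
  then have "integrable lborel (\<lambda>x :: real. exp (- x\<^sup>2 / 2))"
    by (simp add: normal_density_def)
  from lborel_integrable_real_affine[OF this, of e 0] show ?thesis
    using assms by simp
qed

text \<open>This is the characteristic function of the standard normal law, rescaled by
  \<open>e\<close>.\<close>

lemma gaussian_fourier:
  fixes e :: real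
  assumes "e > 0"
  shows "(LINT x|lborel. exp (- (e * x)\<^sup>2 / 2) *\<^sub>R cis (x * y))
    = complex_of_real (sqrt (2 * pi) / e * exp (- (y / e)\<^sup>2 / 2))"
proof -
  have "complex_of_real (exp (- (y / e)\<^sup>2 / 2)) = char std_normal_distribution (y / e)"
    by (simp add: char_std_normal_distribution)
  also have "\<dots> = (LINT x|lborel. std_normal_density x *\<^sub>R cis (y / e * x))"
    unfolding char_def by (subst integral_density) (auto simp: cis_conv_exp normal_density_nonneg)
  also have "\<dots> = e *\<^sub>R (LINT x|lborel. std_normal_density (e * x) *\<^sub>R cis (y / e * (e * x)))"
    using assms by (subst lborel_integral_real_affine[where c = e and t = 0]) auto
  also have "\<dots> = e *\<^sub>R (LINT x|lborel. (1 / sqrt (2 * pi)) *\<^sub>R (exp (- (e * x)\<^sup>2 / 2) *\<^sub>R cis (x * y)))"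
    using assms by (simp add: normal_density_def mult.commute)
  also have "\<dots> = (e / sqrt (2 * pi)) *\<^sub>R (LINT x|lborel. exp (- (e * x)\<^sup>2 / 2) *\<^sub>R cis (x * y))"
    by (subst integral_scaleR_right) simp
  finally have *: "complex_of_real (exp (- (y / e)\<^sup>2 / 2)) = \<dots>" .
  have "(LINT x|lborel. exp (- (e * x)\<^sup>2 / 2) *\<^sub>R cis (x * y))
      = (sqrt (2 * pi) / e) *\<^sub>R ((e / sqrt (2 * pi)) *\<^sub>R (LINT x|lborel. exp (- (e * x)\<^sup>2 / 2) *\<^sub>R cis (x * y)))"
    using assms by simp
  also have "\<dots> = complex_of_real (sqrt (2 * pi) / e * exp (- (y / e)\<^sup>2 / 2))"
    unfolding *[symmetric] by (simp add: scaleR_conv_of_real)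
  finally show ?thesis .
qed

lemma tendsto_0_of_ennreal_square:
  assumes "(\<lambda>j. (f j)\<^sup>2 :: ennreal) \<longlonglongrightarrow> 0"
  shows "f \<longlonglongrightarrow> 0"
proof (rule order_tendstoI)
  fix a :: ennreal assume "0 < a"
  then have "0 < a\<^sup>2" by (simp add: zero_less_iff_neq_zero)
  from order_tendstoD(2)[OF assms this] show "\<forall>\<^sub>F j in sequentially. f j < a"
    by eventually_elim (metis linorder_not_less power_mono zero_le)
qed simp

text \<open>A Gaussian weight in \<tau> is a Gaussian average in t. For \<open>g\<close> truncated
  to [-j,j] this is Fubini. As j grows, the time side converges by domination, the frequency side
  because L^2 convergence is tested against the square integrable weight \<open>W\<close>. The
  hypothesis on \<open>g\<close>, a constant plus an integrable function, is what a spatial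
  coefficient of a square integrable function satisfies.\<close>

lemma inversion_gaussian:
  fixes g Fg :: "real \<Rightarrow> complex" and m :: "real \<Rightarrow> real"
  assumes g [measurable]: "g \<in> borel_measurable lborel"
    and gm: "AE t in lborel. cmod (g t) \<le> C + m t" and m: "integrable lborel m"
    and Fg: "integrable lborel Fg"
    and lim: "((\<lambda>R. \<integral>\<^sup>+\<tau>. ennreal ((cmod ((LINT t:{-R..R}|lborel. g t * cis (- (t * \<tau>))) - Fg \<tau>))\<^sup>2) \<partial>lborel) \<longlongrightarrow> 0) at_top"
    and e: "e > 0"
  shows "integrable lborel (\<lambda>t. (sqrt (2 * pi) / e * exp (- ((t0 - t) / e)\<^sup>2 / 2)) *\<^sub>R g t)"
    and "(LINT t|lborel. (sqrt (2 * pi) / e * exp (- ((t0 - t) / e)\<^sup>2 / 2)) *\<^sub>R g t)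
      = (LINT \<tau>|lborel. exp (- (e * \<tau>)\<^sup>2 / 2) *\<^sub>R (cis (\<tau> * t0) * Fg \<tau>))"
proof -
  define k where "k t = sqrt (2 * pi) / e * exp (- ((t0 - t) / e)\<^sup>2 / 2)" for t
  define W where "W \<tau> = exp (- (e * \<tau>)\<^sup>2 / 2)" for \<tau>
  have k_nonneg: "0 \<le> k t" for t using e by (simp add: k_def)
  have k_bound: "k t \<le> sqrt (2 * pi) / e" for t
    using e unfolding k_def by (intro mult_left_le) auto
  have k_meas [measurable]: "k \<in> borel_measurable lborel" unfolding k_def by measurable
  have W_meas [measurable]: "W \<in> borel_measurable lborel" unfolding W_def by measurable
  have W_int: "integrable lborel W" unfolding W_def by (rule gaussian_integrable[OF e])
  have W_nonneg: "0 \<le> W \<tau>" and W_le1: "W \<tau> \<le> 1" for \<tau> by (simp_all add: W_def)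
  have [measurable]: "m \<in> borel_measurable lborel" using m by simp
  have k_int: "integrable lborel k"
  proof -
    have "integrable lborel (\<lambda>t. exp (- (1 / e * t)\<^sup>2 / 2))"
      using e by (intro gaussian_integrable) simp
    from lborel_integrable_real_affine[OF this, of "-1" t0]
    have "integrable lborel (\<lambda>t. exp (- ((t0 - t) / e)\<^sup>2 / 2))" by simp
    then show ?thesis unfolding k_def by (rule integrable_mult_right)
  qed
  \<comment> \<open>The kernel is integrable against the constant \<open>C\<close> and bounded
    against the integrable \<open>m\<close>.\<close>
  have kg_bound: "norm (k t *\<^sub>R g t) \<le> norm (C * k t + (sqrt (2 * pi) / e) * \<bar>m t\<bar>)"
    if gm: "cmod (g t) \<le> C + m t" for t
  proof -
    have "norm (k t *\<^sub>R g t) \<le> k t * (C + m t)"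
      using gm k_nonneg[of t] by (simp add: mult_left_mono)
    also have "\<dots> \<le> C * k t + k t * \<bar>m t\<bar>"
      using k_nonneg[of t] mult_left_mono[of "m t" "\<bar>m t\<bar>" "k t"] by (simp add: algebra_simps)
    also have "\<dots> \<le> C * k t + (sqrt (2 * pi) / e) * \<bar>m t\<bar>"
      using k_bound[of t] mult_right_mono[of "k t" "sqrt (2 * pi) / e" "\<bar>m t\<bar>"] by simp
    finally show ?thesis by simp
  qed
  have kg_int: "integrable lborel (\<lambda>t. k t *\<^sub>R g t)"
  proof (rule Bochner_Integration.integrable_bound)
    show "integrable lborel (\<lambda>t. C * k t + (sqrt (2 * pi) / e) * \<bar>m t\<bar>)"
      using k_int m by simp
    show "AE t in lborel. norm (k t *\<^sub>R g t) \<le> norm (C * k t + (sqrt (2 * pi) / e) * \<bar>m t\<bar>)"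
      using gm by eventually_elim (rule kg_bound)
  qed measurable
  then show "integrable lborel (\<lambda>t. (sqrt (2 * pi) / e * exp (- ((t0 - t) / e)\<^sup>2 / 2)) *\<^sub>R g t)"
    by (simp add: k_def)
  define gR where "gR j \<tau> = (LINT t:{- real j..real j}|lborel. g t * cis (- (t * \<tau>)))" for j :: nat and \<tau>
  have g_loc: "integrable lborel (\<lambda>t. indicator {- real j..real j} t *\<^sub>R g t)" for j :: nat
  proof (rule Bochner_Integration.integrable_bound)
    show "integrable lborel (\<lambda>t. C * indicator {- real j..real j} t + \<bar>m t\<bar>)"
      using m by simp
    have "norm (indicator {- real j..real j} t *\<^sub>R g t) \<le> norm (C * indicator {- real j..real j} t + \<bar>m t\<bar>)"
      if "cmod (g t) \<le> C + m t" for t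
      using that by (auto split: split_indicator)
    with gm show "AE t in lborel. norm (indicator {- real j..real j} t *\<^sub>R g t) \<le> norm (C * indicator {- real j..real j} t + \<bar>m t\<bar>)"
      by (auto elim: eventually_mono)
  qed measurable
  have gR_meas [measurable]: "gR j \<in> borel_measurable lborel" for j
    unfolding gR_def set_lebesgue_integral_def by measurable
  define cc where "cc \<tau> = W \<tau> *\<^sub>R cis (\<tau> * t0)" for \<tau>
  have cc_meas [measurable]: "cc \<in> borel_measurable lborel" unfolding cc_def by measurable
  have norm_cc: "norm (cc \<tau>) = W \<tau>" for \<tau> using W_nonneg[of \<tau>] by (simp add: cc_def)
  \<comment> \<open>Integrating the absolutely integrable double integrand first in \<tau> produces
    the kernel \<open>k\<close>, first in t the truncated transform \<open>gR j\<close>.\<close>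
  have fub: "integrable lborel (\<lambda>\<tau>. cc \<tau> * gR j \<tau>) \<and>
      (LINT t|lborel. indicator {- real j..real j} t *\<^sub>R (k t *\<^sub>R g t)) = (LINT \<tau>|lborel. cc \<tau> * gR j \<tau>)" for j
  proof -
    let ?f = "\<lambda>t \<tau>. (indicator {- real j..real j} t *\<^sub>R g t) * (W \<tau> *\<^sub>R cis (\<tau> * (t0 - t)))"
    have int: "integrable (lborel \<Otimes>\<^sub>M lborel) (case_prod ?f)"
    proof (rule lborel_pair.Fubini_integrable)
      show "case_prod ?f \<in> borel_measurable (lborel \<Otimes>\<^sub>M lborel)" by measurable
      have "(LINT \<tau>|lborel. norm (case_prod ?f (t, \<tau>))) = norm (indicator {- real j..real j} t *\<^sub>R g t) * integral\<^sup>L lborel W" for t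
        using W_nonneg by (simp add: norm_mult)
      then show "integrable lborel (\<lambda>t. LINT \<tau>|lborel. norm (case_prod ?f (t, \<tau>)))"
        using g_loc[of j] by (simp only:) (intro integrable_mult_left integrable_norm)
      have "integrable lborel (\<lambda>\<tau>. W \<tau> *\<^sub>R cis (\<tau> * (t0 - t)))" for t
        by (rule Bochner_Integration.integrable_bound[OF W_int]) auto
      then show "AE t in lborel. integrable lborel (\<lambda>\<tau>. case_prod ?f (t, \<tau>))"
        unfolding prod.case by (intro AE_I2 integrable_mult_right)
    qed
    have e1: "(LINT \<tau>|lborel. ?f t \<tau>) = indicator {- real j..real j} t *\<^sub>R (k t *\<^sub>R g t)" for t
    proof -
      have "(LINT \<tau>|lborel. ?f t \<tau>) = (indicator {- real j..real j} t *\<^sub>R g t) * (LINT \<tau>|lborel. W \<tau> *\<^sub>R cis (\<tau> * (t0 - t)))"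
        by (rule integral_mult_right_zero)
      also have "(LINT \<tau>|lborel. W \<tau> *\<^sub>R cis (\<tau> * (t0 - t))) = complex_of_real (k t)"
        unfolding W_def k_def by (rule gaussian_fourier[OF e])
      finally show ?thesis by (simp add: scaleR_conv_of_real)
    qed
    have e2: "(LINT t|lborel. ?f t \<tau>) = cc \<tau> * gR j \<tau>" for \<tau>
    proof -
      have "?f t \<tau> = cc \<tau> * (indicator {- real j..real j} t *\<^sub>R (g t * cis (- (t * \<tau>))))" for t
      proof -
        have "cis (\<tau> * (t0 - t)) = cis (\<tau> * t0) * cis (- (t * \<tau>))"
          by (simp add: cis_mult algebra_simps)
        then show ?thesis by (simp add: cc_def scaleR_conv_of_real)
      qed
      then show ?thesis unfolding gR_def set_lebesgue_integral_def
        by (simp only: integral_mult_right_zero)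
    qed
    have "integrable lborel (\<lambda>\<tau>. LINT t|lborel. ?f t \<tau>)"
      using lborel_pair.integrable_snd[OF int] .
    moreover have "(LINT t|lborel. LINT \<tau>|lborel. ?f t \<tau>) = (LINT \<tau>|lborel. LINT t|lborel. ?f t \<tau>)"
      using lborel_pair.Fubini_integral[OF int] by simp
    ultimately show ?thesis unfolding e1 e2 by simp
  qed
  have left: "(\<lambda>j. LINT t|lborel. indicator {- real j..real j} t *\<^sub>R (k t *\<^sub>R g t)) \<longlonglongrightarrow> (LINT t|lborel. k t *\<^sub>R g t)"
  proof (rule integral_dominated_convergence[where w = "\<lambda>t. norm (k t *\<^sub>R g t)"])
    show "AE t in lborel. (\<lambda>j. indicator {- real j..real j} t *\<^sub>R (k t *\<^sub>R g t)) \<longlonglongrightarrow> k t *\<^sub>R g t"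
    proof (intro AE_I2 tendsto_eventually)
      fix t :: real
      obtain N :: nat where "\<bar>t\<bar> \<le> real N" using real_arch_simple by blast
      then have "indicator {- real j..real j} t *\<^sub>R (k t *\<^sub>R g t) = k t *\<^sub>R g t" if "j \<ge> N" for j
        using that by (auto split: split_indicator)
      then show "\<forall>\<^sub>F j in sequentially. indicator {- real j..real j} t *\<^sub>R (k t *\<^sub>R g t) = k t *\<^sub>R g t"
        by (rule eventually_sequentiallyI)
    qed
    show "integrable lborel (\<lambda>t. norm (k t *\<^sub>R g t))" using kg_int by (rule integrable_norm)
    show "AE t in lborel. norm (indicator {- real j..real j} t *\<^sub>R (k t *\<^sub>R g t)) \<le> norm (k t *\<^sub>R g t)" for j
      by (intro AE_I2) (auto split: split_indicator)
  qed measurable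
  have ccF: "integrable lborel (\<lambda>\<tau>. cc \<tau> * Fg \<tau>)"
    using Fg
  proof (rule Bochner_Integration.integrable_bound)
    show "AE \<tau> in lborel. norm (cc \<tau> * Fg \<tau>) \<le> norm (Fg \<tau>)"
      using W_le1 W_nonneg by (intro AE_I2) (simp add: norm_mult norm_cc mult_left_le_one_le)
  qed (use Fg in auto)
  have [measurable]: "Fg \<in> borel_measurable lborel" using Fg by simp
  \<comment> \<open>Cauchy-Schwarz turns the L^2 convergence in the definition of the transform into
    weighted L^1 convergence; \<open>W\<close> is square integrable since 0 \<le> W \<le> 1 gives
    W^2 \<le> W.\<close>
  have nn0: "(\<lambda>j. \<integral>\<^sup>+\<tau>. ennreal (W \<tau>) * ennreal (cmod (gR j \<tau> - Fg \<tau>)) \<partial>lborel) \<longlonglongrightarrow> 0"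
  proof (rule tendsto_0_of_ennreal_square)
    have "(\<lambda>j. (\<integral>\<^sup>+\<tau>. ennreal ((cmod (gR j \<tau> - Fg \<tau>))\<^sup>2) \<partial>lborel)) \<longlonglongrightarrow> 0"
      unfolding gR_def by (rule filterlim_compose[OF lim filterlim_real_sequentially])
    moreover have "(\<integral>\<^sup>+\<tau>. ennreal (W \<tau>) ^ 2 \<partial>lborel) \<noteq> top"
    proof -
      have "(\<integral>\<^sup>+\<tau>. ennreal (W \<tau>) ^ 2 \<partial>lborel) \<le> (\<integral>\<^sup>+\<tau>. ennreal (W \<tau>) \<partial>lborel)"
      proof (rule nn_integral_mono)
        fix \<tau>
        have "(W \<tau>)\<^sup>2 \<le> W \<tau>" using W_le1[of \<tau>] W_nonneg[of \<tau>]
          by (simp add: power2_eq_square mult_left_le_one_le)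
        then show "(ennreal (W \<tau>))\<^sup>2 \<le> ennreal (W \<tau>)"
          using W_nonneg[of \<tau>] by (simp add: ennreal_power ennreal_leI)
      qed
      also have "\<dots> = ennreal (integral\<^sup>L lborel W)"
        using W_int W_nonneg by (intro nn_integral_eq_integral) auto
      finally show ?thesis by (rule neq_top_trans[OF ennreal_neq_top])
    qed
    ultimately have lim0: "(\<lambda>j. (\<integral>\<^sup>+\<tau>. ennreal (W \<tau>) ^ 2 \<partial>lborel) * (\<integral>\<^sup>+\<tau>. ennreal ((cmod (gR j \<tau> - Fg \<tau>))\<^sup>2) \<partial>lborel)) \<longlonglongrightarrow> 0"
      using ennreal_tendsto_cmult[of "\<integral>\<^sup>+\<tau>. ennreal (W \<tau>) ^ 2 \<partial>lborel"] by (fastforce simp: less_top)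
    show "(\<lambda>j. (\<integral>\<^sup>+\<tau>. ennreal (W \<tau>) * ennreal (cmod (gR j \<tau> - Fg \<tau>)) \<partial>lborel)\<^sup>2) \<longlonglongrightarrow> 0"
    proof (rule tendsto_sandwich[OF _ _ tendsto_const lim0])
      show "\<forall>\<^sub>F j in sequentially. (\<integral>\<^sup>+\<tau>. ennreal (W \<tau>) * ennreal (cmod (gR j \<tau> - Fg \<tau>)) \<partial>lborel)\<^sup>2
          \<le> (\<integral>\<^sup>+\<tau>. ennreal (W \<tau>) ^ 2 \<partial>lborel) * (\<integral>\<^sup>+\<tau>. ennreal ((cmod (gR j \<tau> - Fg \<tau>))\<^sup>2) \<partial>lborel)"
      proof (intro always_eventually allI)
        fix j
        show "(\<integral>\<^sup>+\<tau>. ennreal (W \<tau>) * ennreal (cmod (gR j \<tau> - Fg \<tau>)) \<partial>lborel)\<^sup>2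
          \<le> (\<integral>\<^sup>+\<tau>. ennreal (W \<tau>) ^ 2 \<partial>lborel) * (\<integral>\<^sup>+\<tau>. ennreal ((cmod (gR j \<tau> - Fg \<tau>))\<^sup>2) \<partial>lborel)"
          using Cauchy_Schwarz_nn_integral[of "\<lambda>\<tau>. ennreal (W \<tau>)" lborel "\<lambda>\<tau>. ennreal (cmod (gR j \<tau> - Fg \<tau>))"]
          by (simp add: ennreal_power)
      qed
    qed simp
  qed
  have right: "(\<lambda>j. LINT \<tau>|lborel. cc \<tau> * gR j \<tau>) \<longlonglongrightarrow> (LINT \<tau>|lborel. cc \<tau> * Fg \<tau>)"
  proof -
    have "(\<lambda>j. (LINT \<tau>|lborel. cc \<tau> * gR j \<tau>) - (LINT \<tau>|lborel. cc \<tau> * Fg \<tau>)) \<longlonglongrightarrow> 0"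
    proof (subst tendsto_norm_zero_iff[symmetric], subst tendsto_ennreal_iff[symmetric])
      show "(\<lambda>j. ennreal (norm ((LINT \<tau>|lborel. cc \<tau> * gR j \<tau>) - (LINT \<tau>|lborel. cc \<tau> * Fg \<tau>)))) \<longlonglongrightarrow> ennreal 0"
      proof (rule tendsto_sandwich[OF _ _ tendsto_const])
        show "\<forall>\<^sub>F j in sequentially. ennreal (norm ((LINT \<tau>|lborel. cc \<tau> * gR j \<tau>) - (LINT \<tau>|lborel. cc \<tau> * Fg \<tau>)))
            \<le> (\<integral>\<^sup>+\<tau>. ennreal (W \<tau>) * ennreal (cmod (gR j \<tau> - Fg \<tau>)) \<partial>lborel)"
        proof (intro always_eventually allI)
          fix j
          have "(LINT \<tau>|lborel. cc \<tau> * gR j \<tau>) - (LINT \<tau>|lborel. cc \<tau> * Fg \<tau>)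
              = (LINT \<tau>|lborel. cc \<tau> * (gR j \<tau> - Fg \<tau>))"
            using fub[of j] ccF by (simp add: right_diff_distrib)
          then have "ennreal (norm ((LINT \<tau>|lborel. cc \<tau> * gR j \<tau>) - (LINT \<tau>|lborel. cc \<tau> * Fg \<tau>)))
              \<le> (\<integral>\<^sup>+\<tau>. ennreal (norm (cc \<tau> * (gR j \<tau> - Fg \<tau>))) \<partial>lborel)"
            by (simp only:) (rule integral_norm_bound_ennreal, use fub[of j] ccF in \<open>simp add: right_diff_distrib\<close>)
          also have "\<dots> = (\<integral>\<^sup>+\<tau>. ennreal (W \<tau>) * ennreal (cmod (gR j \<tau> - Fg \<tau>)) \<partial>lborel)"
            by (simp add: norm_mult norm_cc ennreal_mult W_nonneg)
          finally show "ennreal (norm ((LINT \<tau>|lborel. cc \<tau> * gR j \<tau>) - (LINT \<tau>|lborel. cc \<tau> * Fg \<tau>)))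
            \<le> (\<integral>\<^sup>+\<tau>. ennreal (W \<tau>) * ennreal (cmod (gR j \<tau> - Fg \<tau>)) \<partial>lborel)" .
        qed
      qed (use nn0 in auto)
    qed auto
    then show ?thesis by (simp add: LIM_zero_iff)
  qed
  have "(LINT t|lborel. k t *\<^sub>R g t) = (LINT \<tau>|lborel. cc \<tau> * Fg \<tau>)"
    by (rule LIMSEQ_unique[OF left]) (use right fub in simp)
  then show "(LINT t|lborel. (sqrt (2 * pi) / e * exp (- ((t0 - t) / e)\<^sup>2 / 2)) *\<^sub>R g t)
      = (LINT \<tau>|lborel. exp (- (e * \<tau>)\<^sup>2 / 2) *\<^sub>R (cis (\<tau> * t0) * Fg \<tau>))"
    by (simp add: k_def cc_def W_def)
qed

text \<open>The kernel is an approximate identity of total mass 2 pi: substituting t = t0 + e u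
  turns it into 2 pi times the standard normal density, independent of \<open>e\<close>.\<close>

lemma gaussian_average_tendsto:
  fixes c :: "real \<Rightarrow> complex"
  assumes cont: "continuous_on UNIV c" and B: "\<And>t. cmod (c t) \<le> B"
    and e_pos: "\<And>j. e j > 0" and e_lim: "e \<longlonglongrightarrow> 0"
  shows "(\<lambda>j. LINT t|lborel. (sqrt (2 * pi) / e j * exp (- ((t0 - t) / e j)\<^sup>2 / 2)) *\<^sub>R c t)
    \<longlonglongrightarrow> 2 * pi * c t0"
proof -
  have [measurable]: "c \<in> borel_measurable borel"
    using cont by (rule borel_measurable_continuous_onI)
  have eq: "(LINT t|lborel. (sqrt (2 * pi) / e j * exp (- ((t0 - t) / e j)\<^sup>2 / 2)) *\<^sub>R c t)
      = (LINT u|lborel. (2 * pi * std_normal_density u) *\<^sub>R c (t0 + e j * u))" for j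
  proof -
    have "(LINT t|lborel. (sqrt (2 * pi) / e j * exp (- ((t0 - t) / e j)\<^sup>2 / 2)) *\<^sub>R c t)
        = e j *\<^sub>R (LINT u|lborel. (sqrt (2 * pi) / e j * exp (- ((t0 - (t0 + e j * u)) / e j)\<^sup>2 / 2)) *\<^sub>R c (t0 + e j * u))"
      using e_pos[of j] by (subst lborel_integral_real_affine[where c = "e j" and t = t0]) auto
    also have "\<dots> = (LINT u|lborel. e j *\<^sub>R ((sqrt (2 * pi) / e j * exp (- ((t0 - (t0 + e j * u)) / e j)\<^sup>2 / 2)) *\<^sub>R c (t0 + e j * u)))"
      by (rule integral_scaleR_right[symmetric])
    also have "\<dots> = (LINT u|lborel. (2 * pi * std_normal_density u) *\<^sub>R c (t0 + e j * u))"
    proof (rule Bochner_Integration.integral_cong[OF refl])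
      fix u
      have "2 * pi * std_normal_density u = (2 * pi / sqrt (2 * pi)) * exp (- u\<^sup>2 / 2)"
        by (simp add: normal_density_def)
      also have "\<dots> = sqrt (2 * pi) * exp (- u\<^sup>2 / 2)"
        by (subst real_div_sqrt) auto
      finally show "e j *\<^sub>R ((sqrt (2 * pi) / e j * exp (- ((t0 - (t0 + e j * u)) / e j)\<^sup>2 / 2)) *\<^sub>R c (t0 + e j * u))
          = (2 * pi * std_normal_density u) *\<^sub>R c (t0 + e j * u)"
        using e_pos[of j] by simp
    qed
    finally show ?thesis .
  qed
  have "(\<lambda>j. LINT u|lborel. (2 * pi * std_normal_density u) *\<^sub>R c (t0 + e j * u))
      \<longlonglongrightarrow> (LINT u|lborel. (2 * pi * std_normal_density u) *\<^sub>R c t0)"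
  proof (rule integral_dominated_convergence[where w = "\<lambda>u. 2 * pi * std_normal_density u * B"])
    show "AE u in lborel. (\<lambda>j. (2 * pi * std_normal_density u) *\<^sub>R c (t0 + e j * u)) \<longlonglongrightarrow> (2 * pi * std_normal_density u) *\<^sub>R c t0"
    proof (intro AE_I2 tendsto_scaleR tendsto_const)
      fix u
      have "isCont c t0" using cont by (simp add: continuous_on_eq_continuous_at)
      moreover have "(\<lambda>j. t0 + e j * u) \<longlonglongrightarrow> t0 + 0 * u"
        by (intro tendsto_intros e_lim)
      ultimately show "(\<lambda>j. c (t0 + e j * u)) \<longlonglongrightarrow> c t0"
        by (intro isCont_tendsto_compose[of t0 c]) simp_all
    qed
    show "AE u in lborel. norm ((2 * pi * std_normal_density u) *\<^sub>R c (t0 + e j * u)) \<le> 2 * pi * std_normal_density u * B" for j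
      using B by (intro AE_I2) (simp add: abs_mult normal_density_nonneg mult_left_mono)
  qed auto
  also have "(LINT u|lborel. (2 * pi * std_normal_density u) *\<^sub>R c t0) = 2 * pi * c t0"
    by (simp add: scaleR_conv_of_real)
  finally show ?thesis unfolding eq .
qed

text \<open>At distance y \<ge> \<eta> from \<open>t0\<close> the kernel is at most a constant times
  e/(1+y^2). This bound is integrable, which handles the constant \<open>C\<close>, and bounded,
  which handles \<open>m\<close>; the factor e gives the limit.\<close>

lemma gaussian_tail_tendsto:
  fixes r :: "real \<Rightarrow> complex" and m :: "real \<Rightarrow> real"
  assumes r [measurable]: "r \<in> borel_measurable lborel"
    and rm: "AE t in lborel. cmod (r t) \<le> C + m t" and m: "integrable lborel m"
    and "\<eta> > 0" and r0: "AE t in lborel. \<bar>t0 - t\<bar> < \<eta> \<longrightarrow> r t = 0"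
    and e_pos: "\<And>j. e j > 0" and e_lim: "e \<longlonglongrightarrow> 0"
  shows "(\<lambda>j. LINT t|lborel. (sqrt (2 * pi) / e j * exp (- ((t0 - t) / e j)\<^sup>2 / 2)) *\<^sub>R r t) \<longlonglongrightarrow> 0"
proof -
  \<comment> \<open>The factor 2 comes from exp(-z) \<le> 1/z with z = (y/e)^2/2, and 1 + 1/\<eta>^2
    converts 1/y^2 into 1/(1+y^2) where |y| \<ge> \<eta>.\<close>
  define A where "A = 2 * sqrt (2 * pi) * (1 + 1 / \<eta>\<^sup>2)"
  define w where "w t = A * (\<bar>C\<bar> * japanese (t - t0) powr (- (2 * 1)) + \<bar>m t\<bar>)" for t
  have A: "A \<ge> 0" by (simp add: A_def)
  have w_int: "integrable lborel w"
    unfolding w_def using integrable_japanese_powr[of 1 "- t0"] m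
    by (intro integrable_mult_right Bochner_Integration.integrable_add integrable_abs) auto
  have bound: "(sqrt (2 * pi) / e j * exp (- ((t0 - t) / e j)\<^sup>2 / 2)) * cmod (r t) \<le> e j * w t"
    if "\<bar>t0 - t\<bar> < \<eta> \<longrightarrow> r t = 0" and rm: "cmod (r t) \<le> C + m t" for t j
  proof (cases "r t = 0")
    case True
    then show ?thesis using A e_pos[of j] by (simp add: w_def)
  next
    case False
    define y where "y = t0 - t"
    have y: "\<bar>y\<bar> \<ge> \<eta>" using that(1) False by (auto simp: y_def)
    then have y2: "y\<^sup>2 \<ge> \<eta>\<^sup>2" using \<open>\<eta> > 0\<close> by (metis abs_le_square_iff abs_of_pos)
    have y2pos: "y\<^sup>2 > 0" using y \<open>\<eta> > 0\<close> by auto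
    have p: "e j > 0" by (rule e_pos)
    have "exp (- (y / e j)\<^sup>2 / 2) \<le> 2 * (e j)\<^sup>2 / y\<^sup>2"
    proof -
      have "(y / e j)\<^sup>2 / 2 \<le> exp ((y / e j)\<^sup>2 / 2)"
        using exp_ge_add_one_self[of "(y / e j)\<^sup>2 / 2"] by linarith
      then have "inverse (exp ((y / e j)\<^sup>2 / 2)) \<le> inverse ((y / e j)\<^sup>2 / 2)"
        using y2pos p by (intro le_imp_inverse_le) (auto simp: power_divide)
      then show ?thesis by (simp add: exp_minus power_divide mult.commute)
    qed
    then have "sqrt (2 * pi) / e j * exp (- (y / e j)\<^sup>2 / 2) \<le> sqrt (2 * pi) / e j * (2 * (e j)\<^sup>2 / y\<^sup>2)"
      using p by (intro mult_left_mono) auto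
    also have "\<dots> = e j * (2 * sqrt (2 * pi) * (1 / y\<^sup>2))"
      using p by (simp add: power2_eq_square field_simps)
    also have "\<dots> \<le> e j * (A * (1 / (1 + y\<^sup>2)))"
    proof -
      have "1 + y\<^sup>2 \<le> (1 + 1 / \<eta>\<^sup>2) * y\<^sup>2"
        using y2 \<open>\<eta> > 0\<close> by (simp add: field_simps)
      then have "1 / y\<^sup>2 \<le> (1 + 1 / \<eta>\<^sup>2) * (1 / (1 + y\<^sup>2))"
        using y2pos by (simp add: field_simps add_pos_nonneg)
      then have "2 * sqrt (2 * pi) * (1 / y\<^sup>2) \<le> 2 * sqrt (2 * pi) * ((1 + 1 / \<eta>\<^sup>2) * (1 / (1 + y\<^sup>2)))"
        by (intro mult_left_mono) auto
      then show ?thesis using p unfolding A_def by (intro mult_left_mono) (auto simp: mult.assoc)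
    qed
    finally have 1: "sqrt (2 * pi) / e j * exp (- (y / e j)\<^sup>2 / 2) \<le> e j * A * (1 / (1 + y\<^sup>2))"
      by simp
    have "japanese (t - t0) powr (- (2 * 1)) = 1 / (1 + y\<^sup>2)"
      using japanese_pos[of "t - t0"]
      by (simp add: powr_minus divide_inverse japanese_real y_def power2_commute add_nonneg_nonneg)
    moreover have "1 / (1 + y\<^sup>2) * \<bar>m t\<bar> \<le> \<bar>m t\<bar>"
      using y2pos by (intro mult_left_le_one_le) (auto simp: divide_le_eq_1 intro: add_pos_pos)
    ultimately have 2: "1 / (1 + y\<^sup>2) * (\<bar>C\<bar> + \<bar>m t\<bar>) \<le> \<bar>C\<bar> * japanese (t - t0) powr (- (2 * 1)) + \<bar>m t\<bar>"
      by (simp add: algebra_simps add_divide_distrib)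
    have "(sqrt (2 * pi) / e j * exp (- (y / e j)\<^sup>2 / 2)) * cmod (r t)
        \<le> (e j * A * (1 / (1 + y\<^sup>2))) * (\<bar>C\<bar> + \<bar>m t\<bar>)"
      using rm p A by (intro mult_mono 1) auto
    also have "\<dots> = (e j * A) * (1 / (1 + y\<^sup>2) * (\<bar>C\<bar> + \<bar>m t\<bar>))" by simp
    also have "\<dots> \<le> (e j * A) * (\<bar>C\<bar> * japanese (t - t0) powr (- (2 * 1)) + \<bar>m t\<bar>)"
      using p A by (intro mult_left_mono 2) auto
    finally show ?thesis by (simp add: w_def y_def mult.assoc)
  qed
  show ?thesis
  proof (rule Lim_null_comparison)
    show "\<forall>\<^sub>F j in sequentially. norm (LINT t|lborel. (sqrt (2 * pi) / e j * exp (- ((t0 - t) / e j)\<^sup>2 / 2)) *\<^sub>R r t)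
        \<le> e j * integral\<^sup>L lborel w"
    proof (intro always_eventually allI)
      fix j
      have ae: "AE t in lborel. norm ((sqrt (2 * pi) / e j * exp (- ((t0 - t) / e j)\<^sup>2 / 2)) *\<^sub>R r t) \<le> e j * w t"
        using r0 rm by eventually_elim (use bound e_pos[of j] in simp)
      have int: "integrable lborel (\<lambda>t. e j * w t)" using w_int by simp
      have "norm (LINT t|lborel. (sqrt (2 * pi) / e j * exp (- ((t0 - t) / e j)\<^sup>2 / 2)) *\<^sub>R r t) \<le> (LINT t|lborel. e j * w t)"
        by (rule norm_integral_le_AE[OF int _ ae]) measurable
      then show "norm (LINT t|lborel. (sqrt (2 * pi) / e j * exp (- ((t0 - t) / e j)\<^sup>2 / 2)) *\<^sub>R r t) \<le> e j * integral\<^sup>L lborel w"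
        by simp
    qed
    show "(\<lambda>j. e j * integral\<^sup>L lborel w) \<longlonglongrightarrow> 0"
      using tendsto_mult_left_zero[OF e_lim] .
  qed
qed

text \<open>The inversion is local: \<open>g\<close> is a bounded continuous function plus a
  remainder vanishing near \<open>t0\<close>. Gaussian averages recover the value of the first and
  annihilate the second, while integrability of \<open>Fg\<close> lets the regularisation be removed
  on the frequency side.\<close>

lemma fourier_inversion_at:
  fixes g Fg c :: "real \<Rightarrow> complex" and m :: "real \<Rightarrow> real"
  assumes g [measurable]: "g \<in> borel_measurable lborel"
    and gm: "AE t in lborel. cmod (g t) \<le> C + m t" and m: "integrable lborel m"
    and Fg: "integrable lborel Fg"
    and lim: "((\<lambda>R. \<integral>\<^sup>+\<tau>. ennreal ((cmod ((LINT t:{-R..R}|lborel. g t * cis (- (t * \<tau>))) - Fg \<tau>))\<^sup>2) \<partial>lborel) \<longlongrightarrow> 0) at_top"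
    and ab: "a < t0" "t0 < b" and cont: "continuous_on {a..b} c"
    and gc: "AE t in lborel. t \<in> {a..b} \<longrightarrow> g t = c t"
  shows "(LINT \<tau>|lborel. cis (\<tau> * t0) * Fg \<tau>) = 2 * pi * c t0"
proof -
  define e where "e j = 1 / real (Suc j)" for j
  have e_pos: "e j > 0" for j by (simp add: e_def)
  have e_lim: "e \<longlonglongrightarrow> 0" unfolding e_def
    using LIMSEQ_inverse_real_of_nat by (simp add: inverse_eq_divide)
  define k where "k j t = sqrt (2 * pi) / e j * exp (- ((t0 - t) / e j)\<^sup>2 / 2)" for j t
  \<comment> \<open>Clamping the argument extends \<open>c\<close> to a bounded continuous function
    on the line, equal to \<open>g\<close> almost everywhere on [a,b].\<close>
  define c1 where "c1 t = c (max a (min b t))" for t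
  have c1_cont: "continuous_on UNIV c1"
    unfolding c1_def using ab by (intro continuous_on_compose2[OF cont] continuous_intros) auto
  have [measurable]: "c1 \<in> borel_measurable borel"
    using c1_cont by (rule borel_measurable_continuous_onI)
  obtain B where B: "\<And>t. t \<in> {a..b} \<Longrightarrow> cmod (c t) \<le> B"
    using compact_continuous_image[OF cont] compact_imp_bounded by (metis bounded_iff compact_Icc imageI)
  have c1_B: "cmod (c1 t) \<le> B" for t
    unfolding c1_def using ab by (intro B) auto
  define r where "r t = g t - c1 t" for t
  have r_meas: "r \<in> borel_measurable lborel" unfolding r_def by measurable
  have r_bound: "AE t in lborel. cmod (r t) \<le> (C + B) + m t"
    using gm
  proof eventually_elim
    case (elim t)
    then show ?case
      unfolding r_def using norm_triangle_ineq4[of "g t" "c1 t"] c1_B[of t] by linarith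
  qed
  define \<eta> where "\<eta> = min (t0 - a) (b - t0)"
  have \<eta>: "\<eta> > 0" using ab by (simp add: \<eta>_def)
  have r0: "AE t in lborel. \<bar>t0 - t\<bar> < \<eta> \<longrightarrow> r t = 0"
    using gc
  proof eventually_elim
    case (elim t)
    show ?case
    proof
      assume "\<bar>t0 - t\<bar> < \<eta>"
      then have "a \<le> t" "t \<le> b" by (auto simp: \<eta>_def)
      with elim show "r t = 0" by (simp add: r_def c1_def)
    qed
  qed
  have lim1: "(\<lambda>j. LINT t|lborel. k j t *\<^sub>R c1 t) \<longlonglongrightarrow> 2 * pi * c1 t0"
    unfolding k_def by (rule gaussian_average_tendsto[OF c1_cont c1_B e_pos e_lim])
  have lim2: "(\<lambda>j. LINT t|lborel. k j t *\<^sub>R r t) \<longlonglongrightarrow> 0"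
    unfolding k_def by (rule gaussian_tail_tendsto[OF r_meas r_bound m \<eta> r0 e_pos e_lim])
  have k_int: "integrable lborel (k j)" for j
  proof -
    have "integrable lborel (\<lambda>t. exp (- (1 / e j * t)\<^sup>2 / 2))"
      using e_pos[of j] by (intro gaussian_integrable) simp
    from lborel_integrable_real_affine[OF this, of "-1" t0]
    have "integrable lborel (\<lambda>t. exp (- ((t0 - t) / e j)\<^sup>2 / 2))" by simp
    then show ?thesis unfolding k_def by (rule integrable_mult_right)
  qed
  have kc1: "integrable lborel (\<lambda>t. k j t *\<^sub>R c1 t)" for j
  proof (rule Bochner_Integration.integrable_bound)
    show "integrable lborel (\<lambda>t. B * k j t)" using k_int by simp
    have "0 \<le> k j t" for t using e_pos[of j] by (simp add: k_def)
    then show "AE t in lborel. norm (k j t *\<^sub>R c1 t) \<le> norm (B * k j t)"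
      using c1_B by (intro AE_I2) (smt (verit) abs_mult mult.commute mult_left_mono norm_scaleR real_norm_def)
    show "(\<lambda>t. k j t *\<^sub>R c1 t) \<in> borel_measurable lborel"
      using k_int by (intro borel_measurable_scaleR) auto
  qed
  have kg: "integrable lborel (\<lambda>t. k j t *\<^sub>R g t)" for j
    unfolding k_def by (rule inversion_gaussian(1)[OF g gm m Fg lim e_pos])
  have "(LINT t|lborel. k j t *\<^sub>R g t) = (LINT t|lborel. k j t *\<^sub>R c1 t) + (LINT t|lborel. k j t *\<^sub>R r t)" for j
    unfolding r_def scaleR_diff_right using kc1[of j] kg[of j] by simp
  with tendsto_add[OF lim1 lim2]
  have L1: "(\<lambda>j. LINT t|lborel. k j t *\<^sub>R g t) \<longlonglongrightarrow> 2 * pi * c1 t0" by simp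
  have eq: "(LINT t|lborel. k j t *\<^sub>R g t)
      = (LINT \<tau>|lborel. exp (- (e j * \<tau>)\<^sup>2 / 2) *\<^sub>R (cis (\<tau> * t0) * Fg \<tau>))" for j
    unfolding k_def by (rule inversion_gaussian(2)[OF g gm m Fg lim e_pos])
  have L2: "(\<lambda>j. LINT \<tau>|lborel. exp (- (e j * \<tau>)\<^sup>2 / 2) *\<^sub>R (cis (\<tau> * t0) * Fg \<tau>))
      \<longlonglongrightarrow> (LINT \<tau>|lborel. cis (\<tau> * t0) * Fg \<tau>)"
  proof (rule integral_dominated_convergence[where w = "\<lambda>\<tau>. norm (Fg \<tau>)"])
    have [measurable]: "Fg \<in> borel_measurable lborel" using Fg by simp
    show "(\<lambda>\<tau>. cis (\<tau> * t0) * Fg \<tau>) \<in> borel_measurable lborel" by measurable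
    show "(\<lambda>\<tau>. exp (- (e j * \<tau>)\<^sup>2 / 2) *\<^sub>R (cis (\<tau> * t0) * Fg \<tau>)) \<in> borel_measurable lborel" for j
      by measurable
    show "integrable lborel (\<lambda>\<tau>. norm (Fg \<tau>))" using Fg by simp
    show "AE \<tau> in lborel. (\<lambda>j. exp (- (e j * \<tau>)\<^sup>2 / 2) *\<^sub>R (cis (\<tau> * t0) * Fg \<tau>)) \<longlonglongrightarrow> cis (\<tau> * t0) * Fg \<tau>"
    proof (intro AE_I2)
      fix \<tau>
      have "(\<lambda>j. exp (- (e j * \<tau>)\<^sup>2 / 2) *\<^sub>R (cis (\<tau> * t0) * Fg \<tau>)) \<longlonglongrightarrow> exp (- (0 * \<tau>)\<^sup>2 / 2) *\<^sub>R (cis (\<tau> * t0) * Fg \<tau>)"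
        by (intro tendsto_intros e_lim) simp
      then show "(\<lambda>j. exp (- (e j * \<tau>)\<^sup>2 / 2) *\<^sub>R (cis (\<tau> * t0) * Fg \<tau>)) \<longlonglongrightarrow> cis (\<tau> * t0) * Fg \<tau>" by simp
    qed
    show "AE \<tau> in lborel. norm (exp (- (e j * \<tau>)\<^sup>2 / 2) *\<^sub>R (cis (\<tau> * t0) * Fg \<tau>)) \<le> norm (Fg \<tau>)" for j
      by (intro AE_I2) (simp add: norm_mult mult_left_le_one_le)
  qed
  have "(LINT \<tau>|lborel. cis (\<tau> * t0) * Fg \<tau>) = 2 * pi * c1 t0"
    by (rule LIMSEQ_unique[OF L2 L1[unfolded eq]])
  then show ?thesis using ab by (simp add: c1_def)
qed

section \<open>Restriction spaces and shells\<close>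

interpretation lborel_torus: pair_sigma_finite lborel torus
  by (intro pair_sigma_finite.intro lborel.sigma_finite_measure_axioms torus.sigma_finite_measure_axioms)

section \<open>Spatial coefficients as inverse Fourier integrals in time\<close>

lemma continuous_on_LINT_cis:
  fixes F :: "real \<Rightarrow> complex"
  assumes F: "integrable lborel F"
  shows "continuous_on S (\<lambda>t. LINT \<tau>|lborel. cis (\<tau> * t) * F \<tau>)"
proof (rule continuous_on_sequentiallyI)
  fix u :: "nat \<Rightarrow> real" and a assume u: "u \<longlonglongrightarrow> a"
  have [measurable]: "F \<in> borel_measurable lborel" using F by simp
  show "(\<lambda>j. LINT \<tau>|lborel. cis (\<tau> * u j) * F \<tau>) \<longlonglongrightarrow> (LINT \<tau>|lborel. cis (\<tau> * a) * F \<tau>)"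
  proof (rule integral_dominated_convergence[where w = "\<lambda>\<tau>. norm (F \<tau>)"])
    show "AE \<tau> in lborel. (\<lambda>j. cis (\<tau> * u j) * F \<tau>) \<longlonglongrightarrow> cis (\<tau> * a) * F \<tau>"
      unfolding cis_conv_exp by (intro AE_I2 tendsto_intros u)
    show "integrable lborel (\<lambda>\<tau>. norm (F \<tau>))" using F by simp
    show "AE \<tau> in lborel. norm (cis (\<tau> * u j) * F \<tau>) \<le> norm (F \<tau>)" for j
      by (intro AE_I2) (simp add: norm_mult)
  qed measurable
qed

lemma sobolev_fun_integrable:
  assumes "sobolev_fun s f"
  shows "integrable torus f"
proof -
  have "integrable torus (\<lambda>x. 1 + (cmod (f x))\<^sup>2)"
    using assms unfolding sobolev_fun_def by simp
  then show ?thesis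
  proof (rule Bochner_Integration.integrable_bound)
    have "cmod (f x) \<le> norm (1 + (cmod (f x))\<^sup>2)" for x
      using self_le_power[of "cmod (f x)" 2] by (cases "cmod (f x) \<le> 1") (auto simp: add_increasing2)
    then show "AE x in torus. cmod (f x) \<le> norm (1 + (cmod (f x))\<^sup>2)" by simp
  qed (use assms in \<open>simp add: sobolev_fun_def\<close>)
qed

text \<open>Passes from an extension, known only up to null sets, to the coefficient of
  \<open>v t\<close> at every time. Of the four factors 2 pi, three undo the normalisation of
  \<open>fcoef\<close> and one belongs to the inversion in time.\<close>

lemma space_coefficient:
  assumes FT: "spacetime_fourier G Gt" and Gt: "integrable lborel (Gt n)"
    and "\<delta> > 0" and cont: "continuous_on {0..\<delta>} (\<lambda>t. fcoef (v t) n)"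
    and v: "\<And>t. t \<in> {0..\<delta>} \<Longrightarrow> v t \<in> borel_measurable torus"
    and eq: "AE (t, x) in lborel \<Otimes>\<^sub>M torus. t \<in> {0..\<delta>} \<longrightarrow> G t x = v t x"
    and t: "t \<in> {0..\<delta>}"
  shows "(LINT \<tau>|lborel. cis (\<tau> * t) * Gt n \<tau>) = (2 * pi) ^ 4 * fcoef (v t) n"
proof -
  define g where "g t = (LINT x|torus. G t x * cis (- (rvec n \<bullet> x)))" for t
  define m where "m t = (LINT x|torus. (cmod (G t x))\<^sup>2)" for t
  define C where "C = measure torus (space torus)"
  have L2: "L2_spacetime G" using FT by (simp add: spacetime_fourier_def)
  then have G_meas [measurable]: "case_prod G \<in> borel_measurable (lborel \<Otimes>\<^sub>M torus)"
    and G_int: "integrable (lborel \<Otimes>\<^sub>M torus) (\<lambda>(t, x). (cmod (G t x))\<^sup>2)"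
    by (auto simp: L2_spacetime_def)
  have cis_meas [measurable]: "(\<lambda>x. cis (- (rvec n \<bullet> x))) \<in> borel_measurable torus"
    by (intro borel_measurable_torus) measurable
  have G_sec [measurable]: "G t \<in> borel_measurable torus" for t
    using measurable_Pair2[OF G_meas, of t] by simp
  have g_meas: "g \<in> borel_measurable lborel"
    unfolding g_def by measurable
  have m_int: "integrable lborel m"
    using lborel_torus.integrable_fst'[OF G_int] by (simp add: m_def[abs_def])
  \<comment> \<open>Square integrability in space-time yields it in x only for almost every t; the
    bound is a \<le> 1 + a^2 on a set of finite measure.\<close>
  have gm: "AE t in lborel. cmod (g t) \<le> C + m t"
    using lborel_torus.AE_integrable_fst'[OF G_int]
  proof eventually_elim
    case (elim t)
    then have int: "integrable torus (\<lambda>x. 1 + (cmod (G t x))\<^sup>2)" by simp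
    have "cmod (g t) \<le> (LINT x|torus. 1 + (cmod (G t x))\<^sup>2)"
      unfolding g_def
    proof (rule norm_integral_le_AE[OF int])
      have "cmod (G t x) \<le> 1 + (cmod (G t x))\<^sup>2" for x
        using self_le_power[of "cmod (G t x)" 2] by (cases "cmod (G t x) \<le> 1") (auto simp: add_increasing2)
      then show "AE x in torus. cmod (G t x * cis (- (rvec n \<bullet> x))) \<le> 1 + (cmod (G t x))\<^sup>2"
        by (simp add: norm_mult)
    qed measurable
    also have "\<dots> = C + m t" using elim by (simp add: C_def m_def)
    finally show ?case .
  qed
  have lim: "((\<lambda>R. \<integral>\<^sup>+\<tau>. ennreal ((cmod ((LINT t:{-R..R}|lborel. g t * cis (- (t * \<tau>))) - Gt n \<tau>))\<^sup>2) \<partial>lborel) \<longlongrightarrow> 0) at_top"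
  proof -
    have "(LINT x|torus. G t x * cis (- (rvec n \<bullet> x + t * \<tau>))) = g t * cis (- (t * \<tau>))" for t \<tau>
    proof -
      have "G t x * cis (- (rvec n \<bullet> x + t * \<tau>)) = G t x * cis (- (rvec n \<bullet> x)) * cis (- (t * \<tau>))" for x
        by (simp add: cis_mult)
      then show ?thesis unfolding g_def by (simp only: integral_mult_left_zero)
    qed
    moreover have "((\<lambda>R. \<integral>\<^sup>+\<tau>. ennreal ((cmod ((LINT t:{-R..R}|lborel.
        LINT x|torus. G t x * cis (- (rvec n \<bullet> x + t * \<tau>))) - Gt n \<tau>))\<^sup>2) \<partial>lborel) \<longlongrightarrow> 0) at_top"
      using FT unfolding spacetime_fourier_def by blast
    ultimately show ?thesis by (simp only:)
  qed
  have gc: "AE t in lborel. t \<in> {0..\<delta>} \<longrightarrow> g t = (2 * pi) ^ 3 * fcoef (v t) n"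
    using lborel_torus.AE_pair[OF eq]
  proof eventually_elim
    case (elim t)
    show ?case
    proof
      assume t: "t \<in> {0..\<delta>}"
      with elim have ae: "AE x in torus. G t x = v t x" by simp
      have [measurable]: "v t \<in> borel_measurable torus" by (rule v[OF t])
      have "g t = (LINT x|torus. v t x * cis (- (rvec n \<bullet> x)))"
        unfolding g_def
      proof (rule integral_cong_AE)
        show "AE x in torus. G t x * cis (- (rvec n \<bullet> x)) = v t x * cis (- (rvec n \<bullet> x))"
          using ae by eventually_elim simp
      qed measurable
      then show "g t = (2 * pi) ^ 3 * fcoef (v t) n" by (simp add: fcoef_def)
    qed
  qed
  define D where "D t = (LINT \<tau>|lborel. cis (\<tau> * t) * Gt n \<tau>) - (2 * pi) ^ 4 * fcoef (v t) n" for t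
  have "D t = 0"
  \<comment> \<open>Inversion applies only at interior times. Both sides are continuous on the
    closed interval, so the identity extends to the endpoints, in particular to t = 0.\<close>
  proof (rule continuous_constant_on_closure[where f = D and S = "{0<..<\<delta>}"])
    have cl: "closure {0<..<\<delta>} = {0..\<delta>}" using \<open>\<delta> > 0\<close> by simp
    show "continuous_on (closure {0<..<\<delta>}) D"
      unfolding D_def cl by (intro continuous_intros continuous_on_LINT_cis Gt cont)
    show "t \<in> closure {0<..<\<delta>}" using t cl by simp
    fix t0 assume "t0 \<in> {0<..<\<delta>}"
    then have t0: "0 < t0" "t0 < \<delta>" by auto
    have "(LINT \<tau>|lborel. cis (\<tau> * t0) * Gt n \<tau>) = 2 * pi * ((2 * pi) ^ 3 * fcoef (v t0) n)"
      by (rule fourier_inversion_at[OF g_meas gm m_int Gt lim t0 _ gc])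
         (intro continuous_intros cont)
    then show "D t0 = 0" by (simp add: D_def power_numeral_reduce)
  qed
  then show ?thesis by (simp add: D_def)
qed

text \<open>The propagator factors into a phase in t and a function \<open>q\<close> of \<tau>
  alone, so the Duhamel term is a continuous phase times an indefinite integral of \<open>q\<close>.
  Of the cubic term only the integrability contained in \<open>duhamel_eq\<close> is needed.\<close>

lemma duhamel_eq_continuous:
  assumes "duhamel_eq sg \<kappa> \<delta> u0 u1 up um v"
  shows "continuous_on {0..\<delta>} (\<lambda>t. fcoef (v t) n)"
proof (cases "\<delta> \<ge> 0")
  case True
  define q where "q \<tau> = cis (sg * \<tau> * japanese (rvec n)) / complex_of_real (japanese (rvec n))
       * fcoef (\<lambda>x. (half_sum up um \<tau> x) ^ 3) n" for \<tau>
  have dq: "duhamel_integrand sg up um t n \<tau> = cis (- (sg * t * japanese (rvec n))) * q \<tau>" for t \<tau>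
  proof -
    have "cis (- (sg * (t - \<tau>) * japanese (rvec n)))
        = cis (- (sg * t * japanese (rvec n))) * cis (sg * \<tau> * japanese (rvec n))"
      by (simp add: cis_mult algebra_simps)
    then show ?thesis by (simp add: duhamel_integrand_def q_def)
  qed
  have "set_integrable lborel {0..\<delta>} (duhamel_integrand sg up um \<delta> n)"
    using assms True by (simp add: duhamel_eq_def)
  moreover have "duhamel_integrand sg up um \<delta> n = (\<lambda>\<tau>. cis (- (sg * \<delta> * japanese (rvec n))) * q \<tau>)"
    by (rule ext) (rule dq)
  ultimately have q: "set_integrable lborel {0..\<delta>} q" by simp
  have "q integrable_on {0..\<delta>}" using set_borel_integral_eq_integral(1)[OF q] .
  then have "continuous_on {0..\<delta>} (\<lambda>t. integral {0..t} q)"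
    by (rule indefinite_integral_continuous_1)
  moreover have "(LINT \<tau>:{0..t}|lborel. duhamel_integrand sg up um t n \<tau>)
      = cis (- (sg * t * japanese (rvec n))) * integral {0..t} q" if "t \<in> {0..\<delta>}" for t
  proof -
    have "set_integrable lborel {0..t} q"
      by (rule set_integrable_subset[OF q]) (use that in auto)
    from set_borel_integral_eq_integral(2)[OF this] show ?thesis
      unfolding dq by simp
  qed
  ultimately have "continuous_on {0..\<delta>} (\<lambda>t. cis (- (sg * t * japanese (rvec n))) * data_coef sg u0 u1 n
          + complex_of_real sg * \<i> * complex_of_real \<kappa>
            * (LINT \<tau>:{0..t}|lborel. duhamel_integrand sg up um t n \<tau>))"
    by (subst continuous_on_cong[OF refl, where g = "\<lambda>t. cis (- (sg * t * japanese (rvec n))) * data_coef sg u0 u1 n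
          + complex_of_real sg * \<i> * complex_of_real \<kappa> * (cis (- (sg * t * japanese (rvec n))) * integral {0..t} q)"])
       (auto intro!: continuous_intros continuous_on_cis)
  then show ?thesis
    by (rule continuous_on_eq) (use assms in \<open>simp add: duhamel_eq_def\<close>)
qed simp

lemma duhamel_eq_initial:
  assumes "duhamel_eq sg \<kappa> \<delta> u0 u1 up um v" "\<delta> \<ge> 0"
  shows "fcoef (v 0) n = data_coef sg u0 u1 n"
proof -
  have "(LINT \<tau>:{0..0}|lborel. duhamel_integrand sg up um 0 n \<tau>) = 0"
    unfolding set_lebesgue_integral_def
    by (rule integral_eq_zero_AE) (use AE_lborel_singleton[of 0] in \<open>auto elim!: eventually_mono\<close>)
  then show ?thesis using assms by (auto simp: duhamel_eq_def)
qed

section \<open>Unit shells and comparison of weights\<close>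

definition shell :: "nat \<Rightarrow> (int^3) set" where
  "shell j = {n. nat \<lceil>norm (rvec n)\<rceil> = j}"

lemma shell_bounds:
  assumes "n \<in> shell j"
  shows "norm (rvec n) \<le> real j" "real j < norm (rvec n) + 1"
  using assms of_int_ceiling_le_add_one[of "norm (rvec n)"] ceiling_correct[of "norm (rvec n)"]
  by (auto simp: shell_def)

lemma finite_shell: "finite (shell j)"
  by (rule finite_subset[OF _ finite_rvec_le[of "real j"]]) (auto dest: shell_bounds(1))

text \<open>Since radii are rounded up, closed balls of integer radius are exactly unions of shells,
  starting from \<open>shell 0\<close>, which contains only n = 0.\<close>

lemma ball_eq_Union_shell: "{n. norm (rvec n) \<le> real N} = (\<Union>j\<le>N. shell j)"
  by (auto simp: shell_def ceiling_le_iff nat_le_iff)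

lemma freq_proj_shell:
  "freq_proj (real N) f x = (\<Sum>j\<le>N. \<Sum>n\<in>shell j. fcoef f n * cis (rvec n \<bullet> x))"
  unfolding freq_proj_def ball_eq_Union_shell
  by (rule sum.UNION_disjoint) (auto simp: finite_shell, auto simp: shell_def)

lemma suminf_shell:
  fixes f :: "int^3 \<Rightarrow> ennreal"
  shows "(\<Sum>j. \<Sum>n\<in>shell j. f n) = (\<integral>\<^sup>+n. f n \<partial>count_space UNIV)"
proof -
  have "(\<integral>\<^sup>+n. f n \<partial>count_space UNIV) = (\<integral>\<^sup>+n. (\<Sum>j. f n * indicator (shell j) n) \<partial>count_space UNIV)"
  proof (rule nn_integral_cong)
    fix n :: "int^3"
    have "(\<Sum>j. f n * indicator (shell j) n) = (\<Sum>j\<in>{nat \<lceil>norm (rvec n)\<rceil>}. f n * indicator (shell j) n)"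
      by (rule suminf_finite) (auto simp: shell_def)
    then show "f n = (\<Sum>j. f n * indicator (shell j) n)" by (simp add: shell_def)
  qed
  also have "\<dots> = (\<Sum>j. \<integral>\<^sup>+n. f n * indicator (shell j) n \<partial>count_space UNIV)"
    by (rule nn_integral_suminf) auto
  also have "\<dots> = (\<Sum>j. \<Sum>n\<in>shell j. f n)"
    by (subst nn_integral_indicator_finite) (auto simp: finite_shell)
  finally show ?thesis by simp
qed

text \<open>An additive substitute for Cauchy-Schwarz: the two terms can be integrated and summed
  over the shells separately. If a w \<le> 1 the first term suffices, otherwise the second.\<close>

lemma le_inverse_plus_weighted_square:
  fixes a w :: real
  assumes "w > 0" "a \<ge> 0"
  shows "a \<le> 1 / w + w * a\<^sup>2"
proof (cases "a * w \<le> 1")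
  case True
  then have "a \<le> 1 / w" using assms by (simp add: field_simps)
  then show ?thesis using assms by (simp add: add_increasing2)
next
  case False
  then have "a * 1 \<le> a * (a * w)" using assms by (intro mult_left_mono) auto
  then have "a \<le> w * a\<^sup>2" by (simp add: power2_eq_square mult_ac)
  then show ?thesis using assms by (simp add: add_increasing)
qed

lemma japanese_le_1_plus_norm: "japanese x \<le> 1 + norm x"
  unfolding japanese_def by (rule real_le_lsqrt) (auto simp: power2_eq_square algebra_simps)

text \<open>
  On the shell \<open>j\<close> the frequency \<open>\<langle>n\<rangle>\<close> is \<open>j\<close> up to an error of at most one, so the modulation weight is
  essentially the same for all the \<open>n\<close> in it.
\<close>

lemma modulation_shell:
  assumes "n \<in> shell j" "\<bar>sg\<bar> = 1"
  shows "japanese (\<tau> + sg * real j) \<le> 3 * japanese (\<tau> + sg * japanese (rvec n))"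
proof -
  \<comment> \<open>From below \<langle>n\<rangle> \<ge> |n| > j - 1, from above \<langle>n\<rangle>
    \<le> 1 + |n| \<le> 1 + j.\<close>
  have "\<bar>japanese (rvec n) - real j\<bar> \<le> 1"
    using shell_bounds[OF assms(1)] norm_le_japanese[of "rvec n"] japanese_le_1_plus_norm[of "rvec n"]
    by linarith
  then have "\<bar>sg * real j - sg * japanese (rvec n)\<bar> \<le> 1"
    using assms(2) by (simp add: abs_mult abs_minus_commute flip: right_diff_distrib)
  then have "\<bar>\<tau> + sg * real j\<bar> \<le> \<bar>\<tau> + sg * japanese (rvec n)\<bar> + 1" by linarith
  then have "japanese (\<tau> + sg * real j) \<le> 2 + \<bar>\<tau> + sg * japanese (rvec n)\<bar>"
    using japanese_le_1_plus_norm[of "\<tau> + sg * real j"] by simp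
  also have "\<dots> \<le> 3 * japanese (\<tau> + sg * japanese (rvec n))"
    using norm_le_japanese[of "\<tau> + sg * japanese (rvec n)"] japanese_ge_1[of "\<tau> + sg * japanese (rvec n)"] by simp
  finally show ?thesis .
qed

lemma frequency_shell:
  assumes "n \<in> shell j"
  shows "1 + real j \<le> 3 * japanese (rvec n)"
  using shell_bounds[OF assms] norm_le_japanese[of "rvec n"] japanese_ge_1[of "rvec n"] by linarith

text \<open>Each of the two comparisons loses a factor 3, raised here to the exponent of its weight.
  This is the direction needed to bound the weight attached to the shell by that of the restriction
  norm.\<close>

lemma X_weight_shell:
  assumes "n \<in> shell j" "\<bar>sg\<bar> = 1" "0 \<le> b" "0 \<le> s"
  shows "japanese (\<tau> + sg * real j) powr (2 * b) * (1 + real j) powr (2 * s)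
    \<le> 3 powr (2 * b) * 3 powr (2 * s)
      * (japanese (\<tau> + sg * japanese (rvec n)) powr (2 * b) * japanese (rvec n) powr (2 * s))"
proof -
  have "japanese (\<tau> + sg * real j) powr (2 * b) \<le> (3 * japanese (\<tau> + sg * japanese (rvec n))) powr (2 * b)"
    using modulation_shell[OF assms(1,2), of \<tau>] japanese_pos[of "\<tau> + sg * real j"] assms(3)
    by (intro powr_mono2) auto
  moreover have "(1 + real j) powr (2 * s) \<le> (3 * japanese (rvec n)) powr (2 * s)"
    using frequency_shell[OF assms(1)] assms(4) by (intro powr_mono2) auto
  ultimately have "japanese (\<tau> + sg * real j) powr (2 * b) * (1 + real j) powr (2 * s)
      \<le> (3 * japanese (\<tau> + sg * japanese (rvec n))) powr (2 * b) * (3 * japanese (rvec n)) powr (2 * s)"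
    by (intro mult_mono) auto
  then show ?thesis
    using japanese_pos[of "rvec n"] japanese_pos[of "\<tau> + sg * japanese (rvec n)"]
    by (simp add: powr_mult mult_ac)
qed

section \<open>Integrable majorants uniform in time\<close>

lemma X_norm_coef_integrable:
  assumes Gt [measurable]: "Gt n \<in> borel_measurable lborel"
    and fin: "X_norm_sq sg s b Gt < \<infinity>" and "1/2 < b" "0 \<le> s"
  shows "integrable lborel (Gt n)"
proof (rule integrableI_bounded)
  let ?w = "\<lambda>\<tau>. japanese (\<tau> + sg * japanese (rvec n)) powr (2 * b)"
  let ?j = "\<lambda>\<tau>. japanese (\<tau> + sg * japanese (rvec n)) powr (- (2 * b))"
  have "(\<integral>\<^sup>+\<tau>. ennreal (norm (Gt n \<tau>)) \<partial>lborel)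
      \<le> (\<integral>\<^sup>+\<tau>. ennreal (?j \<tau>) + ennreal (?w \<tau> * japanese (rvec n) powr (2 * s) * (cmod (Gt n \<tau>))\<^sup>2) \<partial>lborel)"
  proof (rule nn_integral_mono)
    fix \<tau>
    \<comment> \<open>The same inequality as for shells, now for one frequency and with the
      modulation weight centred at its own \<langle>n\<rangle>. The square term is one summand of
      the restriction norm.\<close>
    have "norm (Gt n \<tau>) \<le> 1 / ?w \<tau> + ?w \<tau> * (cmod (Gt n \<tau>))\<^sup>2"
      using japanese_pos[of "\<tau> + sg * japanese (rvec n)"] by (intro le_inverse_plus_weighted_square) auto
    also have "\<dots> \<le> ?j \<tau> + ?w \<tau> * japanese (rvec n) powr (2 * s) * (cmod (Gt n \<tau>))\<^sup>2"
    proof -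
      have "1 \<le> japanese (rvec n) powr (2 * s)"
        using japanese_ge_1[of "rvec n"] \<open>0 \<le> s\<close> by (intro ge_one_powr_ge_zero) auto
      then have "?w \<tau> * 1 * (cmod (Gt n \<tau>))\<^sup>2 \<le> ?w \<tau> * japanese (rvec n) powr (2 * s) * (cmod (Gt n \<tau>))\<^sup>2"
        by (intro mult_right_mono mult_left_mono) auto
      then show ?thesis by (simp add: powr_minus divide_inverse)
    qed
    finally show "ennreal (norm (Gt n \<tau>)) \<le> ennreal (?j \<tau>)
        + ennreal (?w \<tau> * japanese (rvec n) powr (2 * s) * (cmod (Gt n \<tau>))\<^sup>2)"
      by (simp add: ennreal_leI flip: ennreal_plus)
  qed
  also have "\<dots> = (\<integral>\<^sup>+\<tau>. ennreal (?j \<tau>) \<partial>lborel)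
      + (\<integral>\<^sup>+\<tau>. ennreal (?w \<tau> * japanese (rvec n) powr (2 * s) * (cmod (Gt n \<tau>))\<^sup>2) \<partial>lborel)"
    by (rule nn_integral_add) measurable
  also have "\<dots> < \<infinity>"
  proof -
    have "(\<integral>\<^sup>+\<tau>. ennreal (?j \<tau>) \<partial>lborel) = ennreal (integral\<^sup>L lborel ?j)"
      by (rule nn_integral_eq_integral[OF integrable_japanese_powr[OF \<open>1/2 < b\<close>]]) auto
    moreover have "(\<integral>\<^sup>+\<tau>. ennreal (?w \<tau> * japanese (rvec n) powr (2 * s) * (cmod (Gt n \<tau>))\<^sup>2) \<partial>lborel)
        \<le> X_norm_sq sg s b Gt"
      unfolding X_norm_sq_def by (intro nn_integral_mono nn_integral_ge_point) simp
    ultimately show ?thesis using fin by (auto simp: less_top[symmetric] top_unique)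
  qed
  finally show "(\<integral>\<^sup>+\<tau>. ennreal (norm (Gt n \<tau>)) \<partial>lborel) < \<infinity>" .
qed measurable

text \<open>For the inverse weight, translation in \<tau> removes both j and the sign, leaving the
  constant \<open>I\<close> times (1+j)^(-2s). For the square term, Parseval at fixed \<tau> and the
  comparison of weights leave the share of the shell in the restriction norm, and these shares add
  up to the norm.\<close>

lemma shell_majorant_integrable:
  assumes Gt [measurable]: "\<And>n. Gt n \<in> borel_measurable lborel"
    and fin: "X_norm_sq sg s b Gt < \<infinity>" and b: "1/2 < b" and s: "1/2 < s" and sg: "\<bar>sg\<bar> = 1"
  shows "(\<integral>\<^sup>+x. (\<Sum>j. \<integral>\<^sup>+\<tau>. ennreal (cmod (\<Sum>n\<in>shell j. Gt n \<tau> * cis (rvec n \<bullet> x))) \<partial>lborel) \<partial>torus) < \<infinity>"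
proof -
  define S where "S j \<tau> x = (\<Sum>n\<in>shell j. Gt n \<tau> * cis (rvec n \<bullet> x))" for j \<tau> x
  define w where "w j \<tau> = japanese (\<tau> + sg * real j) powr (2 * b) * (1 + real j) powr (2 * s)" for j \<tau>
  define wi where "wi j \<tau> = japanese (\<tau> + sg * real j) powr (- (2 * b)) * (1 + real j) powr (- (2 * s))" for j \<tau>
  define K where "K = 3 powr (2 * b) * 3 powr (2 * s)"
  define f where "f n \<tau> = japanese (\<tau> + sg * japanese (rvec n)) powr (2 * b)
      * japanese (rvec n) powr (2 * s) * (cmod (Gt n \<tau>))\<^sup>2" for n \<tau>
  define I where "I = (\<integral>\<^sup>+\<tau>. ennreal (japanese (\<tau> :: real) powr (- (2 * b))) \<partial>lborel)"
  have w_pos: "w j \<tau> > 0" for j \<tau> unfolding w_def using japanese_pos[of "\<tau> + sg * real j"] by simp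
  have wi_nonneg: "wi j \<tau> \<ge> 0" for j \<tau> unfolding wi_def by simp
  have wi: "wi j \<tau> = 1 / w j \<tau>" for j \<tau>
    unfolding wi_def w_def by (simp add: powr_minus divide_inverse)
  have [measurable]: "w j \<in> borel_measurable lborel" "wi j \<in> borel_measurable lborel" for j
    unfolding w_def wi_def by measurable
  have cis_torus [measurable]: "(\<lambda>x. cis (rvec n \<bullet> x)) \<in> borel_measurable torus" for n
    by (intro borel_measurable_torus) measurable
  have S_meas [measurable]: "(\<lambda>(\<tau>, x). S j \<tau> x) \<in> borel_measurable (lborel \<Otimes>\<^sub>M torus)"
    "(\<lambda>(x, \<tau>). S j \<tau> x) \<in> borel_measurable (torus \<Otimes>\<^sub>M lborel)" for j
    unfolding S_def by measurable
  \<comment> \<open>Parseval acts at fixed \<tau>, so x must become the inner variable.\<close>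
  have fubini: "(\<integral>\<^sup>+x. \<integral>\<^sup>+\<tau>. ennreal (w j \<tau> * (cmod (S j \<tau> x))\<^sup>2) \<partial>lborel \<partial>torus)
      = (\<integral>\<^sup>+\<tau>. \<integral>\<^sup>+x. ennreal (w j \<tau> * (cmod (S j \<tau> x))\<^sup>2) \<partial>torus \<partial>lborel)" for j
    by (rule lborel_torus.Fubini') measurable
  have inner: "(\<integral>\<^sup>+x. ennreal (w j \<tau> * (cmod (S j \<tau> x))\<^sup>2) \<partial>torus)
      \<le> ennreal ((2 * pi) ^ 3 * K) * (\<Sum>n\<in>shell j. ennreal (f n \<tau>))" for j \<tau>
  proof -
    have "(\<integral>\<^sup>+x. ennreal (w j \<tau> * (cmod (S j \<tau> x))\<^sup>2) \<partial>torus)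
        = ennreal (w j \<tau>) * (\<integral>\<^sup>+x. ennreal ((cmod (S j \<tau> x))\<^sup>2) \<partial>torus)"
      using w_pos[of j \<tau>] by (simp add: ennreal_mult nn_integral_cmult S_def)
    also have "\<dots> = ennreal (w j \<tau>) * ennreal ((2 * pi) ^ 3 * (\<Sum>n\<in>shell j. (cmod (Gt n \<tau>))\<^sup>2))"
      unfolding S_def by (subst parseval_torus[OF finite_shell]) simp
    also have "\<dots> = ennreal ((2 * pi) ^ 3 * (\<Sum>n\<in>shell j. w j \<tau> * (cmod (Gt n \<tau>))\<^sup>2))"
      using w_pos[of j \<tau>] by (simp add: sum_distrib_left mult_ac sum_nonneg flip: ennreal_mult)
    also have "\<dots> \<le> ennreal ((2 * pi) ^ 3 * (\<Sum>n\<in>shell j. K * f n \<tau>))"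
    proof (intro ennreal_leI mult_left_mono sum_mono)
      fix n assume n: "n \<in> shell j"
      have "w j \<tau> * (cmod (Gt n \<tau>))\<^sup>2 \<le> K * (japanese (\<tau> + sg * japanese (rvec n)) powr (2 * b)
          * japanese (rvec n) powr (2 * s)) * (cmod (Gt n \<tau>))\<^sup>2"
        unfolding w_def K_def using b s by (intro mult_right_mono X_weight_shell[OF n sg]) auto
      then show "w j \<tau> * (cmod (Gt n \<tau>))\<^sup>2 \<le> K * f n \<tau>" by (simp add: f_def mult_ac)
    qed simp
    also have "\<dots> = ennreal ((2 * pi) ^ 3 * K) * (\<Sum>n\<in>shell j. ennreal (f n \<tau>))"
      by (subst sum_ennreal) (auto simp: f_def K_def sum_nonneg sum_distrib_left mult_ac simp flip: ennreal_mult)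
    finally show ?thesis .
  qed
  have Q_le: "(\<integral>\<^sup>+x. \<integral>\<^sup>+\<tau>. ennreal (cmod (S j \<tau> x)) \<partial>lborel \<partial>torus)
      \<le> emeasure torus (space torus) * I * ennreal ((1 + real j) powr (- (2 * s)))
        + ennreal ((2 * pi) ^ 3 * K) * (\<integral>\<^sup>+\<tau>. (\<Sum>n\<in>shell j. ennreal (f n \<tau>)) \<partial>lborel)" for j
  proof -
    have "(\<integral>\<^sup>+x. \<integral>\<^sup>+\<tau>. ennreal (cmod (S j \<tau> x)) \<partial>lborel \<partial>torus)
        \<le> (\<integral>\<^sup>+x. \<integral>\<^sup>+\<tau>. ennreal (wi j \<tau>) + ennreal (w j \<tau> * (cmod (S j \<tau> x))\<^sup>2) \<partial>lborel \<partial>torus)"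
    proof (intro nn_integral_mono)
      fix x \<tau>
      have "cmod (S j \<tau> x) \<le> wi j \<tau> + w j \<tau> * (cmod (S j \<tau> x))\<^sup>2"
        unfolding wi by (intro le_inverse_plus_weighted_square w_pos) simp
      then show "ennreal (cmod (S j \<tau> x)) \<le> ennreal (wi j \<tau>) + ennreal (w j \<tau> * (cmod (S j \<tau> x))\<^sup>2)"
        using wi_nonneg[of j \<tau>] w_pos[of j \<tau>] by (simp add: ennreal_leI flip: ennreal_plus)
    qed
    also have "\<dots> = (\<integral>\<^sup>+x. (\<integral>\<^sup>+\<tau>. ennreal (wi j \<tau>) \<partial>lborel) + (\<integral>\<^sup>+\<tau>. ennreal (w j \<tau> * (cmod (S j \<tau> x))\<^sup>2) \<partial>lborel) \<partial>torus)"
    proof (intro nn_integral_cong nn_integral_add)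
      show "(\<lambda>\<tau>. ennreal (w j \<tau> * (cmod (S j \<tau> x))\<^sup>2)) \<in> borel_measurable lborel" for x
        unfolding S_def by measurable
    qed measurable
    also have "\<dots> = (\<integral>\<^sup>+x. (\<integral>\<^sup>+\<tau>. ennreal (wi j \<tau>) \<partial>lborel) \<partial>torus)
        + (\<integral>\<^sup>+x. \<integral>\<^sup>+\<tau>. ennreal (w j \<tau> * (cmod (S j \<tau> x))\<^sup>2) \<partial>lborel \<partial>torus)"
      by (rule nn_integral_add) measurable
    also have "(\<integral>\<^sup>+\<tau>. ennreal (wi j \<tau>) \<partial>lborel) = I * ennreal ((1 + real j) powr (- (2 * s)))"
    proof -
      have "(\<integral>\<^sup>+\<tau>. ennreal (wi j \<tau>) \<partial>lborel)
          = (\<integral>\<^sup>+\<tau>. ennreal (japanese (\<tau> + sg * real j) powr (- (2 * b))) \<partial>lborel) * ennreal ((1 + real j) powr (- (2 * s)))"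
        unfolding wi_def by (subst nn_integral_multc[symmetric]) (auto simp: ennreal_mult)
      also have "(\<integral>\<^sup>+\<tau>. ennreal (japanese (\<tau> + sg * real j) powr (- (2 * b))) \<partial>lborel) = I"
        unfolding I_def by (subst nn_integral_real_affine[where c = 1 and t = "- (sg * real j)"]) (auto simp: add.commute)
      finally show ?thesis .
    qed
    also have "(\<integral>\<^sup>+x. I * ennreal ((1 + real j) powr (- (2 * s))) \<partial>torus)
        = emeasure torus (space torus) * I * ennreal ((1 + real j) powr (- (2 * s)))"
      by (simp add: mult_ac)
    also have "(\<integral>\<^sup>+x. \<integral>\<^sup>+\<tau>. ennreal (w j \<tau> * (cmod (S j \<tau> x))\<^sup>2) \<partial>lborel \<partial>torus)
        \<le> (\<integral>\<^sup>+\<tau>. ennreal ((2 * pi) ^ 3 * K) * (\<Sum>n\<in>shell j. ennreal (f n \<tau>)) \<partial>lborel)"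
      unfolding fubini by (intro nn_integral_mono inner)
    also have "\<dots> = ennreal ((2 * pi) ^ 3 * K) * (\<integral>\<^sup>+\<tau>. (\<Sum>n\<in>shell j. ennreal (f n \<tau>)) \<partial>lborel)"
      unfolding f_def by (rule nn_integral_cmult) measurable
    finally show ?thesis by (simp add: add_left_mono)
  qed
  have "(\<integral>\<^sup>+x. (\<Sum>j. \<integral>\<^sup>+\<tau>. ennreal (cmod (S j \<tau> x)) \<partial>lborel) \<partial>torus)
      = (\<Sum>j. \<integral>\<^sup>+x. \<integral>\<^sup>+\<tau>. ennreal (cmod (S j \<tau> x)) \<partial>lborel \<partial>torus)"
    by (rule nn_integral_suminf) measurable
  also have "\<dots> \<le> (\<Sum>j. emeasure torus (space torus) * I * ennreal ((1 + real j) powr (- (2 * s)))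
        + ennreal ((2 * pi) ^ 3 * K) * (\<integral>\<^sup>+\<tau>. (\<Sum>n\<in>shell j. ennreal (f n \<tau>)) \<partial>lborel))"
    by (intro suminf_le Q_le) auto
  also have "\<dots> = (\<Sum>j. emeasure torus (space torus) * I * ennreal ((1 + real j) powr (- (2 * s))))
        + (\<Sum>j. ennreal ((2 * pi) ^ 3 * K) * (\<integral>\<^sup>+\<tau>. (\<Sum>n\<in>shell j. ennreal (f n \<tau>)) \<partial>lborel))"
    by (rule suminf_add[symmetric]) auto
  also have "\<dots> = emeasure torus (space torus) * I * (\<Sum>j. ennreal ((1 + real j) powr (- (2 * s))))
        + ennreal ((2 * pi) ^ 3 * K) * (\<Sum>j. \<integral>\<^sup>+\<tau>. (\<Sum>n\<in>shell j. ennreal (f n \<tau>)) \<partial>lborel)"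
    by simp
  also have "(\<Sum>j. \<integral>\<^sup>+\<tau>. (\<Sum>n\<in>shell j. ennreal (f n \<tau>)) \<partial>lborel) = X_norm_sq sg s b Gt"
  proof -
    have "(\<Sum>j. \<integral>\<^sup>+\<tau>. (\<Sum>n\<in>shell j. ennreal (f n \<tau>)) \<partial>lborel) = (\<integral>\<^sup>+\<tau>. (\<Sum>j. \<Sum>n\<in>shell j. ennreal (f n \<tau>)) \<partial>lborel)"
      unfolding f_def by (rule nn_integral_suminf[symmetric]) measurable
    then show ?thesis unfolding suminf_shell X_norm_sq_def f_def .
  qed
  also have "emeasure torus (space torus) * I * (\<Sum>j. ennreal ((1 + real j) powr (- (2 * s))))
        + ennreal ((2 * pi) ^ 3 * K) * X_norm_sq sg s b Gt < \<infinity>"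
  proof -
    have "I = ennreal (LINT \<tau>|lborel. japanese (\<tau> :: real) powr (- (2 * b)))"
      unfolding I_def using integrable_japanese_powr[OF b, of 0] by (intro nn_integral_eq_integral) auto
    moreover have "(\<Sum>j. ennreal ((1 + real j) powr (- (2 * s)))) = ennreal (\<Sum>j. (1 + real j) powr (- (2 * s)))"
    proof (rule suminf_ennreal2)
      \<comment> \<open>The sum runs over radii, so its convergence is the condition 2s > 1.\<close>
      have "summable (\<lambda>j. real (Suc j) powr (- (2 * s)))"
        using s by (subst summable_Suc_iff) (simp add: summable_real_powr_iff)
      then show "summable (\<lambda>j. (1 + real j) powr (- (2 * s)))" by simp
    qed simp
    moreover have "emeasure torus (space torus) = ennreal (measure torus (space torus))"
      by (rule torus.emeasure_eq_measure)
    ultimately show ?thesis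
      using fin by (auto simp: less_top[symmetric] ennreal_mult_eq_top_iff simp flip: ennreal_mult)
  qed
  finally show ?thesis by (simp add: S_def)
qed

text \<open>A finite infimum yields one extension of finite norm, which need not be minimal.
  \<open>Q\<close> is built from it alone and hence serves all times at once, so that later a single
  null set of x is discarded for all t.\<close>

lemma X_restr_majorant:
  assumes "\<delta> > 0" and b: "1/2 < b" and s: "1/2 < s" and sg: "\<bar>sg\<bar> = 1"
    and fin: "X_restr_norm_sq sg s b \<delta> v < \<infinity>"
    and v: "\<And>t. t \<in> {0..\<delta>} \<Longrightarrow> v t \<in> borel_measurable torus"
    and cont: "\<And>n. continuous_on {0..\<delta>} (\<lambda>t. fcoef (v t) n)"
  obtains Q :: "nat \<Rightarrow> real^3 \<Rightarrow> ennreal" where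
    "\<And>j. Q j \<in> borel_measurable torus"
    "(\<integral>\<^sup>+x. (\<Sum>j. Q j x) \<partial>torus) < \<infinity>"
    "\<And>t j x. t \<in> {0..\<delta>} \<Longrightarrow>
      ennreal (cmod (\<Sum>n\<in>shell j. fcoef (v t) n * cis (rvec n \<bullet> x))) \<le> Q j x"
proof -
  from fin obtain G Gt where FT: "spacetime_fourier G Gt" and X: "X_norm_sq sg s b Gt < \<infinity>"
    and eq: "AE (t, x) in lborel \<Otimes>\<^sub>M torus. t \<in> {0..\<delta>} \<longrightarrow> G t x = v t x"
    unfolding X_restr_norm_sq_def Inf_less_iff by blast
  have Gt_meas [measurable]: "Gt n \<in> borel_measurable lborel" for n
    using FT by (simp add: spacetime_fourier_def)
  have Gt_int: "integrable lborel (Gt n)" for n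
    using b s by (intro X_norm_coef_integrable[OF Gt_meas X]) auto
  define Q where "Q j x = (\<integral>\<^sup>+\<tau>. ennreal (cmod (\<Sum>n\<in>shell j. Gt n \<tau> * cis (rvec n \<bullet> x))) \<partial>lborel)" for j x
  show thesis
  proof
    have [measurable]: "(\<lambda>x. cis (rvec n \<bullet> x)) \<in> borel_measurable torus" for n
      by (intro borel_measurable_torus) measurable
    show "Q j \<in> borel_measurable torus" for j unfolding Q_def by measurable
    show "(\<integral>\<^sup>+x. (\<Sum>j. Q j x) \<partial>torus) < \<infinity>"
      unfolding Q_def by (rule shell_majorant_integrable[OF Gt_meas X b s sg])
    fix t j x assume t: "t \<in> {0..\<delta>}"
    let ?S = "\<Sum>n\<in>shell j. fcoef (v t) n * cis (rvec n \<bullet> x)"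
    have int: "integrable lborel (\<lambda>\<tau>. cis (\<tau> * t) * Gt n \<tau> * cis (rvec n \<bullet> x))" for n
      using Gt_int[of n]
      by (rule Bochner_Integration.integrable_bound) (auto simp: norm_mult)
    have coef: "(LINT \<tau>|lborel. cis (\<tau> * t) * Gt n \<tau>) = (2 * pi) ^ 4 * fcoef (v t) n" for n
      by (rule space_coefficient[OF FT Gt_int \<open>\<delta> > 0\<close> cont v eq t])
    have "(2 * pi) ^ 4 * ?S = (\<Sum>n\<in>shell j. (LINT \<tau>|lborel. cis (\<tau> * t) * Gt n \<tau>) * cis (rvec n \<bullet> x))"
      by (simp add: coef sum_distrib_left mult.assoc)
    also have "\<dots> = (LINT \<tau>|lborel. (\<Sum>n\<in>shell j. cis (\<tau> * t) * Gt n \<tau> * cis (rvec n \<bullet> x)))"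
      using int by (subst Bochner_Integration.integral_sum) auto
    finally have "ennreal (norm ((2 * pi) ^ 4 * ?S))
        \<le> (\<integral>\<^sup>+\<tau>. ennreal (norm (\<Sum>n\<in>shell j. cis (\<tau> * t) * Gt n \<tau> * cis (rvec n \<bullet> x))) \<partial>lborel)"
      by (simp only:) (intro integral_norm_bound_ennreal Bochner_Integration.integrable_sum int)
    \<comment> \<open>Here t disappears: its phase does not depend on \<open>n\<close>, so it leaves
      the sum with modulus 1.\<close>
    also have "\<dots> = Q j x"
      unfolding Q_def by (simp add: mult.assoc norm_mult flip: sum_distrib_left)
    finally have "ennreal (norm ((2 * pi) ^ 4 * ?S)) \<le> Q j x" .
    moreover have "norm ?S \<le> norm ((2 * pi) ^ 4 * ?S)"
    proof -
      have "1 \<le> (2 * pi) ^ 4" using pi_ge_two by (intro one_le_power) simp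
      then have "1 * norm ?S \<le> (2 * pi) ^ 4 * norm ?S" by (intro mult_right_mono) auto
      then show ?thesis by (simp add: norm_mult norm_power)
    qed
    ultimately show "ennreal (cmod ?S) \<le> Q j x"
      using ennreal_leI order.trans by blast
  qed
qed

section \<open>Pointwise convergence\<close>

lemma fcoef_exp_sum:
  assumes "finite A"
  shows "fcoef (\<lambda>x. \<Sum>n\<in>A. a n * cis (rvec n \<bullet> x)) m = (if m \<in> A then a m else 0)"
proof -
  have "(\<Sum>n\<in>A. a n * cis (rvec n \<bullet> x)) * cis (- (rvec m \<bullet> x)) = (\<Sum>n\<in>A. a n * cis (rvec (n - m) \<bullet> x))" for x
    by (simp add: sum_distrib_right mult.assoc cis_mult rvec_diff inner_diff_left)
  moreover have "integrable torus (\<lambda>x. a n * cis (rvec (n - m) \<bullet> x))" for n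
    by (intro continuous_integrable_torus continuous_intros continuous_on_cis)
  ultimately have "(LINT x|torus. (\<Sum>n\<in>A. a n * cis (rvec n \<bullet> x)) * cis (- (rvec m \<bullet> x)))
      = (\<Sum>n\<in>A. a n * (LINT x|torus. cis (rvec (n - m) \<bullet> x)))"
    by (simp add: Bochner_Integration.integral_sum)
  also have "\<dots> = (if m \<in> A then a m * (2 * pi) ^ 3 else 0)"
    using assms by (simp add: LINT_cis if_distrib sum.delta cong: if_cong)
  finally show ?thesis by (simp add: fcoef_def)
qed

text \<open>The Weierstrass test for majorants in [0,\<infinity>]. \<open>T\<close> is the time
  interval at fixed x, or a one-point type when only a numerical series is at stake.\<close>

lemma shell_series_converges:
  fixes Q :: "nat \<Rightarrow> ennreal" and w :: "nat \<Rightarrow> 'a \<Rightarrow> complex"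
  assumes fin: "(\<Sum>j. Q j) < \<infinity>" and le: "\<And>t j. t \<in> T \<Longrightarrow> ennreal (cmod (w j t)) \<le> Q j"
  shows "uniform_limit T (\<lambda>N t. \<Sum>j<N. w j t) (\<lambda>t. \<Sum>j. w j t) sequentially"
    and "\<And>t. t \<in> T \<Longrightarrow> summable (\<lambda>j. cmod (w j t))"
    and "\<And>t N. t \<in> T \<Longrightarrow> cmod (\<Sum>j<N. w j t) \<le> enn2real (\<Sum>j. Q j)"
proof -
  have Qfin: "Q j < \<infinity>" for j
  proof -
    have "Q j \<le> (\<Sum>j. Q j)"
      using sum_le_suminf[of Q "{j}"] by simp
    then show ?thesis using fin by (rule le_less_trans)
  qed
  then have Qe: "Q j = ennreal (enn2real (Q j))" for j by simp
  have wle: "cmod (w j t) \<le> enn2real (Q j)" if "t \<in> T" for j t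
  proof -
    have "ennreal (cmod (w j t)) \<le> ennreal (enn2real (Q j))"
      using le[OF that, of j] Qe[of j] by simp
    then show ?thesis by (subst (asm) ennreal_le_iff) auto
  qed
  have sum: "summable (\<lambda>j. enn2real (Q j))"
  proof (rule summable_suminf_not_top)
    show "(\<Sum>j. ennreal (enn2real (Q j))) \<noteq> top"
      using fin by (simp flip: Qe)
  qed simp
  show "uniform_limit T (\<lambda>N t. \<Sum>j<N. w j t) (\<lambda>t. \<Sum>j. w j t) sequentially"
    by (rule Weierstrass_m_test[OF _ sum]) (rule wle)
  show "summable (\<lambda>j. cmod (w j t))" if "t \<in> T" for t
    by (rule summable_comparison_test'[OF sum, of 0]) (use wle[OF that] in simp)
  show "cmod (\<Sum>j<N. w j t) \<le> enn2real (\<Sum>j. Q j)" if "t \<in> T" for t N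
  proof -
    have "cmod (\<Sum>j<N. w j t) \<le> (\<Sum>j<N. enn2real (Q j))"
      using wle[OF that] by (intro sum_norm_le) auto
    also have "\<dots> \<le> (\<Sum>j. enn2real (Q j))"
      by (rule sum_le_suminf[OF sum]) auto
    also have "\<dots> = enn2real (\<Sum>j. ennreal (enn2real (Q j)))"
      by (subst suminf_ennreal2[OF _ sum]) (simp_all add: suminf_nonneg[OF sum])
    also have "\<dots> = enn2real (\<Sum>j. Q j)" by (simp flip: Qe)
    finally show ?thesis .
  qed
qed

text \<open>Dyadic projections are a subsequence of the partial sums over shells, which converge
  along all integers.\<close>

lemma freq_proj_dyadic_tendsto:
  assumes "summable (\<lambda>j. cmod (\<Sum>n\<in>shell j. fcoef f n * cis (rvec n \<bullet> x)))"
  shows "(\<lambda>k::nat. freq_proj (2 ^ k) f x) \<longlonglongrightarrow> (\<Sum>j. \<Sum>n\<in>shell j. fcoef f n * cis (rvec n \<bullet> x))"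
proof -
  let ?w = "\<lambda>j. \<Sum>n\<in>shell j. fcoef f n * cis (rvec n \<bullet> x)"
  have "(\<lambda>N. \<Sum>j\<le>N. ?w j) \<longlonglongrightarrow> (\<Sum>j. ?w j)"
    using summable_norm_cancel[OF assms] by (rule summable_LIMSEQ')
  moreover have "filterlim (\<lambda>k::nat. 2 ^ k :: nat) sequentially sequentially"
    by (rule filterlim_subseq) (simp add: strict_mono_def)
  ultimately have "(\<lambda>k. \<Sum>j\<le>2 ^ k. ?w j) \<longlonglongrightarrow> (\<Sum>j. ?w j)"
    by (rule filterlim_compose)
  moreover have "freq_proj (2 ^ k) f x = (\<Sum>j\<le>2 ^ k. ?w j)" for k
    using freq_proj_shell[of "2 ^ k" f x] by simp
  ultimately show ?thesis by simp
qed

text \<open>Summability produces some limit \<open>F\<close>; what remains is that it is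
  \<open>f\<close>. The total \<open>H\<close> of the majorants dominates all partial sums almost
  everywhere, so limits pass into the coefficients and uniqueness applies.\<close>

lemma freq_proj_dyadic_tendsto_AE:
  fixes Q :: "nat \<Rightarrow> real^3 \<Rightarrow> ennreal"
  assumes f: "integrable torus f"
    and Q [measurable]: "\<And>j. Q j \<in> borel_measurable torus"
    and fin: "(\<integral>\<^sup>+x. (\<Sum>j. Q j x) \<partial>torus) < \<infinity>"
    and le: "\<And>j x. ennreal (cmod (\<Sum>n\<in>shell j. fcoef f n * cis (rvec n \<bullet> x))) \<le> Q j x"
  shows "AE x in torus. (\<lambda>k::nat. freq_proj (2 ^ k) f x) \<longlonglongrightarrow> f x"
proof -
  define w where "w j x = (\<Sum>n\<in>shell j. fcoef f n * cis (rvec n \<bullet> x))" for j x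
  define F where "F x = (\<Sum>j. w j x)" for x
  have [measurable]: "w j \<in> borel_measurable torus" for j
    unfolding w_def by (intro borel_measurable_torus) measurable
  have [measurable]: "f \<in> borel_measurable torus" using f by simp
  have F_meas [measurable]: "F \<in> borel_measurable torus" unfolding F_def by measurable
  have H_fin: "AE x in torus. (\<Sum>j. Q j x) < \<infinity>"
    using nn_integral_PInf_AE[of "\<lambda>x. \<Sum>j. Q j x" torus] fin
    by (auto simp: less_top)
  \<comment> \<open>\<open>enn2real\<close> sends \<infinity> to 0, so \<open>H\<close> bounds the
    partial sums only off the null set where the series of majorants diverges.\<close>
  define H where "H x = enn2real (\<Sum>j. Q j x)" for x
  have H_int: "integrable torus H"
  proof (rule integrableI_bounded)
    have "(\<integral>\<^sup>+x. ennreal (norm (H x)) \<partial>torus) \<le> (\<integral>\<^sup>+x. (\<Sum>j. Q j x) \<partial>torus)"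
      unfolding H_def by (intro nn_integral_mono) (simp add: ennreal_enn2real_if)
    then show "(\<integral>\<^sup>+x. ennreal (norm (H x)) \<partial>torus) < \<infinity>" using fin by (rule le_less_trans)
    show "H \<in> borel_measurable torus" unfolding H_def by measurable
  qed
  have conv: "AE x in torus. summable (\<lambda>j. cmod (w j x)) \<and> (\<forall>N. cmod (\<Sum>j<N. w j x) \<le> H x)"
    using H_fin
  proof eventually_elim
    case (elim x)
    from shell_series_converges(2,3)[OF this, where T = UNIV and w = "\<lambda>j (_ :: unit). w j x"] le
    show ?case by (simp add: w_def H_def)
  qed
  have lim: "AE x in torus. (\<lambda>N. \<Sum>j<N. w j x) \<longlonglongrightarrow> F x"
    using conv unfolding F_def by eventually_elim (auto intro: summable_LIMSEQ summable_norm_cancel)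
  have F_le: "AE x in torus. cmod (F x) \<le> H x"
    using conv lim
  proof eventually_elim
    case (elim x)
    then show ?case by (intro Lim_bounded[OF tendsto_norm[OF elim(2)], of 0]) auto
  qed
  have F_int: "integrable torus F"
    by (rule Bochner_Integration.integrable_bound[OF H_int F_meas])
       (use F_le in eventually_elim, simp)
  have coef: "fcoef F m = fcoef f m" for m
  proof -
    have [measurable]: "(\<lambda>x. cis (- (rvec m \<bullet> x))) \<in> borel_measurable torus"
      by (intro borel_measurable_torus) measurable
    have "(\<lambda>N. LINT x|torus. (\<Sum>j<N. w j x) * cis (- (rvec m \<bullet> x))) \<longlonglongrightarrow> (LINT x|torus. F x * cis (- (rvec m \<bullet> x)))"
    proof (rule integral_dominated_convergence[OF _ _ H_int])
      show "AE x in torus. (\<lambda>N. (\<Sum>j<N. w j x) * cis (- (rvec m \<bullet> x))) \<longlonglongrightarrow> F x * cis (- (rvec m \<bullet> x))"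
        using lim by eventually_elim (intro tendsto_intros)
      show "AE x in torus. cmod ((\<Sum>j<N. w j x) * cis (- (rvec m \<bullet> x))) \<le> H x" for N
        using conv by eventually_elim (simp add: norm_mult)
    qed measurable
    then have "(\<lambda>N. fcoef (\<lambda>x. \<Sum>j<N. w j x) m) \<longlonglongrightarrow> fcoef F m"
      unfolding fcoef_def by (intro tendsto_intros) auto
    \<comment> \<open>The sum stops before \<open>N\<close>, so \<open>N\<close> must strictly
      exceed the index of the shell containing \<open>m\<close>.\<close>
    moreover have "fcoef (\<lambda>x. \<Sum>j<N. w j x) m = fcoef f m" if "N > nat \<lceil>norm (rvec m)\<rceil>" for N
    proof -
      have "(\<Sum>j<N. w j x) = (\<Sum>n\<in>(\<Union>j<N. shell j). fcoef f n * cis (rvec n \<bullet> x))" for x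
        unfolding w_def by (rule sum.UNION_disjoint[symmetric]) (auto simp: finite_shell, auto simp: shell_def)
      moreover have "m \<in> (\<Union>j<N. shell j)" using that by (auto simp: shell_def)
      ultimately show ?thesis using fcoef_exp_sum[of "\<Union>j<N. shell j" "fcoef f" m]
        by (simp add: finite_shell)
    qed
    then have "(\<lambda>N. fcoef (\<lambda>x. \<Sum>j<N. w j x) m) \<longlonglongrightarrow> fcoef f m"
      by (intro tendsto_eventually eventually_sequentiallyI[of "Suc (nat \<lceil>norm (rvec m)\<rceil>)"]) auto
    ultimately show ?thesis by (rule LIMSEQ_unique)
  qed
  have "AE x in torus. F x - f x = 0"
  proof (rule fcoef_zero_imp_AE_zero)
    show "integrable torus (\<lambda>x. F x - f x)" using F_int f by simp
    fix n
    have int: "integrable torus (\<lambda>x. h x * cis (- (rvec n \<bullet> x)))" if "integrable torus h" for h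
      using that
      by (rule Bochner_Integration.integrable_bound)
         (use that borel_measurable_torus[of "\<lambda>x. cis (- (rvec n \<bullet> x))"] in \<open>auto simp: norm_mult\<close>)
    show "fcoef (\<lambda>x. F x - f x) n = 0"
      using coef[of n] int[OF F_int] int[OF f] by (simp add: fcoef_def left_diff_distrib)
  qed
  with conv show ?thesis
  proof eventually_elim
    case (elim x)
    then have "summable (\<lambda>j. cmod (\<Sum>n\<in>shell j. fcoef f n * cis (rvec n \<bullet> x)))" by (simp add: w_def)
    from freq_proj_dyadic_tendsto[OF this] elim show ?case by (simp add: F_def w_def)
  qed
qed

lemma fcoef_half_sum:
  assumes "integrable torus (up t)" "integrable torus (um t)"
  shows "fcoef (half_sum up um t) n = (fcoef (up t) n + fcoef (um t) n) / 2"
proof -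
  have "integrable torus (\<lambda>x. h x * cis (- (rvec n \<bullet> x)))" if "integrable torus h" for h
    using that
    by (rule Bochner_Integration.integrable_bound)
       (use that borel_measurable_torus[of "\<lambda>x. cis (- (rvec n \<bullet> x))"] in \<open>auto simp: norm_mult\<close>)
  from this[OF assms(1)] this[OF assms(2)] show ?thesis
    by (simp add: fcoef_def half_sum_def distrib_right add_divide_distrib)
qed

section \<open>Continuity in time of the pointwise value\<close>

theorem theorem1p1:
  fixes s s' b \<delta> \<kappa> :: real
    and u0 :: "real^3 \<Rightarrow> real"
    and u1 :: "(real^3 \<Rightarrow> complex) \<Rightarrow> complex"
    and up um :: "real \<Rightarrow> real^3 \<Rightarrow> complex"
  assumes "s > 1/2"
    and "sobolev_fun s (\<lambda>x. complex_of_real (u0 x))"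
    and "sobolev_distr (s - 1) u1" and "real_distribution u1"
    and "\<kappa> \<in> {1, -1}"
    and "1/2 < b" and "b < s'" and "s' < 1" and "s' \<le> s"
    and "\<delta> > 0"
    and "duhamel_solution \<kappa> s' b \<delta> (\<lambda>x. complex_of_real (u0 x)) u1 up um"
  shows "AE x in torus.
           (\<forall>\<^sub>F t in at 0 within {0..\<delta>}. has_ptvalue (half_sum up um t) x) \<and>
           ((\<lambda>t. cmod (ptvalue (half_sum up um t) x - complex_of_real (u0 x))) \<longlongrightarrow> 0)
             (at 0 within {0..\<delta>})"
proof -
  define U where "U = half_sum up um"
  have s': "1/2 < s'" using assms by simp
  have sob: "\<And>t. t \<in> {0..\<delta>} \<Longrightarrow> sobolev_fun s' (up t) \<and> sobolev_fun s' (um t)"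
    and X: "X_restr_norm_sq 1 s' b \<delta> up < \<infinity>" "X_restr_norm_sq (-1) s' b \<delta> um < \<infinity>"
    and D: "duhamel_eq 1 \<kappa> \<delta> u0 u1 up um up" "duhamel_eq (-1) \<kappa> \<delta> u0 u1 up um um"
    using assms(11) unfolding duhamel_solution_def by auto
  have int: "integrable torus (up t)" "integrable torus (um t)" if "t \<in> {0..\<delta>}" for t
    using sob[OF that] sobolev_fun_integrable by blast+
  have meas: "up t \<in> borel_measurable torus" "um t \<in> borel_measurable torus" if "t \<in> {0..\<delta>}" for t
    using int[OF that] by auto
  have cont: "continuous_on {0..\<delta>} (\<lambda>t. fcoef (up t) n)" "continuous_on {0..\<delta>} (\<lambda>t. fcoef (um t) n)" for n
    by (rule duhamel_eq_continuous[OF D(1)], rule duhamel_eq_continuous[OF D(2)])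
  obtain Qp where Qp [measurable]: "\<And>j. Qp j \<in> borel_measurable torus"
    and Qp_fin: "(\<integral>\<^sup>+x. (\<Sum>j. Qp j x) \<partial>torus) < \<infinity>"
    and Qp_le: "\<And>t j x. t \<in> {0..\<delta>} \<Longrightarrow>
      ennreal (cmod (\<Sum>n\<in>shell j. fcoef (up t) n * cis (rvec n \<bullet> x))) \<le> Qp j x"
    using X_restr_majorant[OF \<open>\<delta> > 0\<close> \<open>1/2 < b\<close> s' _ X(1) meas(1) cont(1)] by auto
  obtain Qm where Qm [measurable]: "\<And>j. Qm j \<in> borel_measurable torus"
    and Qm_fin: "(\<integral>\<^sup>+x. (\<Sum>j. Qm j x) \<partial>torus) < \<infinity>"
    and Qm_le: "\<And>t j x. t \<in> {0..\<delta>} \<Longrightarrow>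
      ennreal (cmod (\<Sum>n\<in>shell j. fcoef (um t) n * cis (rvec n \<bullet> x))) \<le> Qm j x"
    using X_restr_majorant[OF \<open>\<delta> > 0\<close> \<open>1/2 < b\<close> s' _ X(2) meas(2) cont(2)] by auto
  define Q where "Q j x = Qp j x + Qm j x" for j x
  have Q [measurable]: "Q j \<in> borel_measurable torus" for j unfolding Q_def by measurable
  have Q_fin: "(\<integral>\<^sup>+x. (\<Sum>j. Q j x) \<partial>torus) < \<infinity>"
  proof -
    have "(\<Sum>j. Q j x) = (\<Sum>j. Qp j x) + (\<Sum>j. Qm j x)" for x
      unfolding Q_def by (rule suminf_add[symmetric]) auto
    then show ?thesis using Qp_fin Qm_fin by (simp add: nn_integral_add)
  qed
  define w where "w x j t = (\<Sum>n\<in>shell j. fcoef (U t) n * cis (rvec n \<bullet> x))" for x j t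
  have coefU: "fcoef (U t) n = (fcoef (up t) n + fcoef (um t) n) / 2" if "t \<in> {0..\<delta>}" for t n
    unfolding U_def by (intro fcoef_half_sum int that)
  have w_le: "ennreal (cmod (w x j t)) \<le> Q j x" if t: "t \<in> {0..\<delta>}" for x j t
  proof -
    let ?p = "\<Sum>n\<in>shell j. fcoef (up t) n * cis (rvec n \<bullet> x)"
    let ?m = "\<Sum>n\<in>shell j. fcoef (um t) n * cis (rvec n \<bullet> x)"
    have "w x j t = (?p + ?m) / 2"
      unfolding w_def coefU[OF t] by (simp add: sum.distrib distrib_right add_divide_distrib flip: sum_divide_distrib)
    then have "cmod (w x j t) = cmod (?p + ?m) / 2" by (simp only: norm_divide) simp
    then have "cmod (w x j t) \<le> cmod ?p + cmod ?m"
      using norm_triangle_ineq[of ?p ?m] norm_ge_zero[of ?p] norm_ge_zero[of ?m] by linarith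
    then have "ennreal (cmod (w x j t)) \<le> ennreal (cmod ?p) + ennreal (cmod ?m)"
      by (simp add: ennreal_leI flip: ennreal_plus)
    also have "\<dots> \<le> Q j x" unfolding Q_def by (intro add_mono Qp_le Qm_le t)
    finally show ?thesis .
  qed
  have w_cont: "continuous_on {0..\<delta>} (w x j)" for x j
  proof -
    have "continuous_on {0..\<delta>} (\<lambda>t. \<Sum>n\<in>shell j. (fcoef (up t) n + fcoef (um t) n) / 2 * cis (rvec n \<bullet> x))"
      by (intro continuous_intros cont) auto
    then show ?thesis
      by (rule continuous_on_eq) (simp add: w_def coefU)
  qed
  have zero: "0 \<in> {0..\<delta>}" using \<open>\<delta> > 0\<close> by simp
  \<comment> \<open>The two terms with \<open>u1\<close> have opposite signs and cancel in the half
    sum.\<close>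
  have U0: "fcoef (U 0) n = fcoef (\<lambda>x. complex_of_real (u0 x)) n" for n
    unfolding coefU[OF zero] duhamel_eq_initial[OF D(1) less_imp_le[OF \<open>\<delta> > 0\<close>]]
      duhamel_eq_initial[OF D(2) less_imp_le[OF \<open>\<delta> > 0\<close>]]
    by (simp add: data_coef_def)
  \<comment> \<open>The bound at time 0 is a bound for the shell pieces of \<open>u0\<close>,
    because only coefficients enter; so the majorant of the solution also gives convergence for the
    data.\<close>
  have u0_lim: "AE x in torus. (\<lambda>k::nat. freq_proj (2 ^ k) (\<lambda>x. complex_of_real (u0 x)) x) \<longlonglongrightarrow> complex_of_real (u0 x)"
  proof (rule freq_proj_dyadic_tendsto_AE[OF _ Q Q_fin])
    show "integrable torus (\<lambda>x. complex_of_real (u0 x))" using assms(2) by (rule sobolev_fun_integrable)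
    show "ennreal (cmod (\<Sum>n\<in>shell j. fcoef (\<lambda>x. complex_of_real (u0 x)) n * cis (rvec n \<bullet> x))) \<le> Q j x" for j x
      using w_le[OF zero, of x j] by (simp add: w_def U0)
  qed
  have "AE x in torus. (\<Sum>j. Q j x) < \<infinity>"
    using nn_integral_PInf_AE[of "\<lambda>x. \<Sum>j. Q j x" torus] Q_fin by (auto simp: less_top)
  \<comment> \<open>Neither of the two null sets depends on t: from here on x is fixed and t ranges
    over the whole interval.\<close>
  with u0_lim show ?thesis
    unfolding U_def[symmetric]
  proof eventually_elim
    case (elim x)
    have uniform: "uniform_limit {0..\<delta>} (\<lambda>N t. \<Sum>j<N. w x j t) (\<lambda>t. \<Sum>j. w x j t) sequentially"
      by (rule shell_series_converges(1)[OF elim(2)]) (rule w_le)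
    have summable: "summable (\<lambda>j. cmod (w x j t))" if "t \<in> {0..\<delta>}" for t
      by (rule shell_series_converges(2)[OF elim(2) _ that]) (rule w_le)
    have lim: "(\<lambda>k::nat. freq_proj (2 ^ k) (U t) x) \<longlonglongrightarrow> (\<Sum>j. w x j t)" if "t \<in> {0..\<delta>}" for t
      using freq_proj_dyadic_tendsto[of "U t" x] summable[OF that] by (simp add: w_def)
    have pt: "has_ptvalue (U t) x" "ptvalue (U t) x = (\<Sum>j. w x j t)" if "t \<in> {0..\<delta>}" for t
      using lim[OF that] by (auto simp: has_ptvalue_def ptvalue_def convergent_def limI)
    have "continuous_on {0..\<delta>} (\<lambda>t. \<Sum>j. w x j t)"
      by (rule uniform_limit_theorem[OF _ uniform]) (auto intro!: always_eventually continuous_on_sum w_cont)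
    then have "((\<lambda>t. \<Sum>j. w x j t) \<longlongrightarrow> (\<Sum>j. w x j 0)) (at 0 within {0..\<delta>})"
      using zero by (simp add: continuous_on_def)
    \<comment> \<open>The projections of \<open>U 0\<close> and of \<open>u0\<close> are the same
      sequence, having the same coefficients, and limits are unique.\<close>
    moreover have "(\<Sum>j. w x j 0) = complex_of_real (u0 x)"
      using LIMSEQ_unique[OF lim[OF zero]] elim(1) by (simp add: freq_proj_def U0)
    ultimately have "((\<lambda>t. cmod ((\<Sum>j. w x j t) - complex_of_real (u0 x))) \<longlongrightarrow> 0) (at 0 within {0..\<delta>})"
      by (simp add: tendsto_norm_zero LIM_zero)
    \<comment> \<open>The pointwise value is identified with the series only for times in the
      interval, which is all the filter sees.\<close>
    moreover have in_I: "\<forall>\<^sub>F t in at 0 within {0..\<delta>}. t \<in> {0..\<delta>}"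
      by (simp add: eventually_at_filter)
    then have "\<forall>\<^sub>F t in at 0 within {0..\<delta>}. cmod ((\<Sum>j. w x j t) - complex_of_real (u0 x)) = cmod (ptvalue (U t) x - complex_of_real (u0 x))"
      by eventually_elim (simp add: pt)
    ultimately have "((\<lambda>t. cmod (ptvalue (U t) x - complex_of_real (u0 x))) \<longlongrightarrow> 0) (at 0 within {0..\<delta>})"
      by (rule Lim_transform_eventually)
    moreover have "\<forall>\<^sub>F t in at 0 within {0..\<delta>}. has_ptvalue (U t) x"
      using in_I by eventually_elim (rule pt)
    ultimately show ?case by blast
  qed
qed

end
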